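(* Let $X,Y\subset\mathbf{R}^n$ be open and bounded and let $b$ be a preference function satisfying hypotheses (B0), (B1) and (B2) listed in the context. Then the set $\mathcal{V}^b_{\overline{Y}}$ of $b$-convex functions on $\overline{X}$ is convex (that is, $(1-t)u_0+tu_1\in\mathcal{V}^b_{\overline{Y}}$ for all $u_0,u_1\in\mathcal{V}^b_{\overline{Y}}$ and $t\in[0,1]$) if and only if $b$ satisfies (B3), non-negative cross-curvature.
   Context: $\overline{Z}$ denotes the closure of a set $Z\subset\mathbf{R}^n$. Hypotheses on $b$: (B0) $b\in C^4(\overline{X}\times\overline{Y})$, where $X,Y\subset\mathbf{R}^n$ are open and bounded. (B1) (bi-twist) For each $(x_0,y_0)\in\overline{X}\times\overline{Y}$, the maps $y\in\overline{Y}\mapsto D_xb(x_0,y)$ and $x\in\overline{X}\mapsto D_yb(x,y_0)$ are diffeomorphisms onto their ranges. (B2) (bi-convexity) For each $(x_0,y_0)\in\overline{X}\times\overline{Y}$, the sets $X_{y_0}:=D_yb(X,y_0)$ and $Y_{x_0}:=D_xb(x_0,Y)$ are convex subsets of $\mathbf{R}^n$. (B3) (non-negative cross-curvature) $$\frac{\partial^4}{\partial s^2\partial t^2}\Big|_{(s,t)=(0,0)}b(x(s),y(t))\ge 0$$ for each curve $t\in[-1,1]\mapsto (D_yb(x(t),y(0)),D_xb(x(0),y(t)))$ forming an affinely parameterized line segment in $\overline{X}_{y(0)}\times\overline{Y}_{x(0)}\subset\mathbf{R}^{2n}$, where $\overline{X}_{y}=D_yb(\overline{X},y)$ and $\overline{Y}_{x}=D_xb(x,\overline{Y})$.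 For $v:\overline{Y}\to\mathbf{R}\cup\{+\infty\}$ and $u:\overline{X}\to\mathbf{R}$ put $$v^b(x)=\sup_{y\in\overline{Y}}\,b(x,y)-v(y),\qquad u^{b^*}(y)=\sup_{x\in\overline{X}}\,b(x,y)-u(x).$$ A function $u:\overline{X}\to\mathbf{R}$ is called $b$-convex if $u=(u^{b^*})^b$. The set of all $b$-convex functions is denoted $\mathcal{V}^b_{\overline{Y}}$. *)

theory Defs
  imports "HOL-Analysis.Analysis"
begin

text \<open>
  \<open>extends_Ck k S f\<close>, for open \<open>S\<close>: \<open>f\<close> is \<open>k\<close> times continuously differentiable on \<open>S\<close>, and
  \<open>f\<close> and all its derivatives of order at most \<open>k\<close> have continuous extensions from \<open>S\<close> to
  \<open>closure S\<close>. Derivatives of higher order are iterated directional derivatives in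
  arbitrary directions \<open>v\<close>.
\<close>

primrec extends_Ck ::
  "nat \<Rightarrow> 'a::real_normed_vector set \<Rightarrow> ('a \<Rightarrow> 'b::real_normed_vector) \<Rightarrow> bool" where
  "extends_Ck 0 S f \<longleftrightarrow> (\<exists>g. continuous_on (closure S) g \<and> (\<forall>x\<in>S. g x = f x))"
| "extends_Ck (Suc k) S f \<longleftrightarrow>
     (\<exists>g. continuous_on (closure S) g \<and> (\<forall>x\<in>S. g x = f x)) \<and>
     (\<forall>x\<in>S. f differentiable (at x)) \<and>
     (\<forall>v. extends_Ck k S (\<lambda>x. frechet_derivative f (at x) v))"

text \<open>The class \<open>C\<^sup>k\<close> of the closure of an open set \<open>S\<close>: the values of \<open>f\<close> on the boundary are
  required to be those of the continuous extension.\<close>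

definition Ck_closure ::
  "nat \<Rightarrow> 'a::real_normed_vector set \<Rightarrow> ('a \<Rightarrow> 'b::real_normed_vector) \<Rightarrow> bool" where
  "Ck_closure k S f \<longleftrightarrow> continuous_on (closure S) f \<and> extends_Ck k S f"

text \<open>A diffeomorphism of \<open>closure S\<close> (\<open>S\<close> open and bounded) onto its range, which is then the
  closure of \<open>f ` S\<close>. The set \<open>f ` S\<close> is open by invariance of domain.\<close>

definition diffeo_onto_range ::
  "'a::euclidean_space set \<Rightarrow> ('a \<Rightarrow> 'a) \<Rightarrow> bool" where
  "diffeo_onto_range S f \<longleftrightarrow>
     (\<exists>g. homeomorphism (closure S) (f ` closure S) f g \<and>
          Ck_closure 1 S f \<and> Ck_closure 1 (f ` S) g)"

definition gradient :: "('a::real_inner \<Rightarrow> real) \<Rightarrow> 'a \<Rightarrow> 'a" where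
  "gradient f x = (THE D. GDERIV f x :> D)"

text \<open>The partial gradients of \<open>b\<close>, extended continuously from \<open>X \<times> Y\<close> to
  \<open>closure X \<times> closure Y\<close>. The limits exist under \<open>B0\<close> below, and on \<open>X \<times> Y\<close> they are the
  gradients themselves.\<close>

definition Dx :: "(real^'n) set \<Rightarrow> (real^'n) set \<Rightarrow> (real^'n \<Rightarrow> real^'n \<Rightarrow> real) \<Rightarrow>
    real^'n \<Rightarrow> real^'n \<Rightarrow> real^'n" where
  "Dx X Y b x0 y0 =
     Lim (at (x0, y0) within X \<times> Y) (\<lambda>(x, y). gradient (\<lambda>x'. b x' y) x)"

definition Dy :: "(real^'n) set \<Rightarrow> (real^'n) set \<Rightarrow> (real^'n \<Rightarrow> real^'n \<Rightarrow> real) \<Rightarrow>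
    real^'n \<Rightarrow> real^'n \<Rightarrow> real^'n" where
  "Dy X Y b x0 y0 =
     Lim (at (x0, y0) within X \<times> Y) (\<lambda>(x, y). gradient (\<lambda>y'. b x y') y)"

definition B0 :: "(real^'n) set \<Rightarrow> (real^'n) set \<Rightarrow> (real^'n \<Rightarrow> real^'n \<Rightarrow> real) \<Rightarrow> bool" where
  "B0 X Y b \<longleftrightarrow> Ck_closure 4 (X \<times> Y) (\<lambda>(x, y). b x y)"

definition B1 :: "(real^'n) set \<Rightarrow> (real^'n) set \<Rightarrow> (real^'n \<Rightarrow> real^'n \<Rightarrow> real) \<Rightarrow> bool" where
  "B1 X Y b \<longleftrightarrow> (\<forall>x0\<in>closure X. \<forall>y0\<in>closure Y.
     diffeo_onto_range Y (\<lambda>y. Dx X Y b x0 y) \<and>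
     diffeo_onto_range X (\<lambda>x. Dy X Y b x y0))"

definition B2 :: "(real^'n) set \<Rightarrow> (real^'n) set \<Rightarrow> (real^'n \<Rightarrow> real^'n \<Rightarrow> real) \<Rightarrow> bool" where
  "B2 X Y b \<longleftrightarrow> (\<forall>x0\<in>closure X. \<forall>y0\<in>closure Y.
     convex ((\<lambda>x. Dy X Y b x y0) ` X) \<and>
     convex ((\<lambda>y. Dx X Y b x0 y) ` Y))"

text \<open>Under \<open>B0\<close>, \<open>B1\<close> and \<open>B2\<close> the iterated derivatives in \<open>B3\<close> exist for all the curves
  concerned; only the values of the curves on \<open>[-1, 1]\<close> matter.\<close>

definition B3 :: "(real^'n) set \<Rightarrow> (real^'n) set \<Rightarrow> (real^'n \<Rightarrow> real^'n \<Rightarrow> real) \<Rightarrow> bool" where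
  "B3 X Y b \<longleftrightarrow> (\<forall>x y :: real \<Rightarrow> real^'n.
     (\<forall>t\<in>{-1..1}. x t \<in> closure X \<and> y t \<in> closure Y) \<longrightarrow>
     (\<exists>p d. \<forall>t\<in>{-1..1}. (Dy X Y b (x t) (y 0), Dx X Y b (x 0) (y t)) = p + t *\<^sub>R d) \<longrightarrow>
     (deriv ^^ 2) (\<lambda>s. (deriv ^^ 2) (\<lambda>t. b (x s) (y t)) 0) 0 \<ge> 0)"

definition b_transform :: "(real^'n) set \<Rightarrow> (real^'n \<Rightarrow> real^'n \<Rightarrow> real) \<Rightarrow>
    (real^'n \<Rightarrow> ereal) \<Rightarrow> real^'n \<Rightarrow> ereal" where
  "b_transform Y b v x = (SUP y\<in>closure Y. ereal (b x y) - v y)"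

definition b_star_transform :: "(real^'n) set \<Rightarrow> (real^'n \<Rightarrow> real^'n \<Rightarrow> real) \<Rightarrow>
    (real^'n \<Rightarrow> real) \<Rightarrow> real^'n \<Rightarrow> ereal" where
  "b_star_transform X b u y = (SUP x\<in>closure X. ereal (b x y) - ereal (u x))"

text \<open>A function on \<open>closure X\<close> is represented by any total function with these values on
  \<open>closure X\<close>; membership does not depend on the values elsewhere.\<close>

definition b_convex_functions :: "(real^'n) set \<Rightarrow> (real^'n) set \<Rightarrow>
    (real^'n \<Rightarrow> real^'n \<Rightarrow> real) \<Rightarrow> (real^'n \<Rightarrow> real) set" where
  "b_convex_functions X Y b =
     {u. \<forall>x\<in>closure X. ereal (u x) = b_transform Y b (b_star_transform X b u) x}"

end

theory Submission
  imports Defs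
begin

text \<open>
  The two sides are linked by a condition that involves no derivative of order higher than one,
  \<open>segment_convexity\<close>: if \<open>y t\<close> is a \<open>b\<close>-segment seen from \<open>x0\<close>, meaning that
  \<open>D\<^sub>xb(x0, y t)\<close> is an affinely parametrized segment, then \<open>t \<mapsto> b x (y t) - b x0 (y t)\<close> is
  convex for every \<open>x\<close>.

  This condition characterizes convexity of the set of \<open>b\<close>-convex functions. A function \<open>u\<close> is
  \<open>b\<close>-convex iff at every point \<open>x0\<close> it is supported from below, up to an arbitrarily small
  error, by a function \<open>b x y - const\<close> (\<open>b_convex_functions_iff\<close>). If \<open>u0\<close> and \<open>u1\<close> are supported
  at \<open>x0\<close> by \<open>y0\<close> and \<open>y1\<close>, segment convexity says that the point \<open>y t\<close> of the \<open>b\<close>-segment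
  from \<open>y0\<close> to \<open>y1\<close> supports \<open>(1 - t) u0 + t u1\<close> (\<open>segment_convexity_imp_convex\<close>). Conversely,
  for the \<open>b\<close>-convex functions \<open>b x y0\<close> and \<open>b x y1\<close> of \<open>x\<close>, the first order condition at an
  interior point \<open>x0\<close> leaves \<open>y t\<close> as the only possible support of the combination, and being a
  support is the inequality of segment convexity (\<open>convex_imp_segment_convexity\<close>).

  Segment convexity is also equivalent to \<open>B3\<close>. Let \<open>G s\<close> be the second derivative in \<open>t\<close> of
  \<open>b (x s) (y t)\<close> at \<open>t = 0\<close>, where \<open>D\<^sub>yb(x s, y 0)\<close> is affine in \<open>s\<close> and \<open>D\<^sub>xb(x 0, y t)\<close> is
  affine in \<open>t\<close>. By the chain rule, \<open>G s\<close> is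
  a quadratic expression in the velocity of \<open>y\<close> at \<open>0\<close> plus the inner product of
  \<open>D\<^sub>yb(x s, y 0)\<close> with the acceleration of \<open>y\<close> at \<open>0\<close>. If segment convexity holds, \<open>G\<close> has a
  minimum at \<open>s = 0\<close>, so its second derivative, the cross-curvature, is nonnegative there
  (\<open>segment_convexity_imp_B3\<close>). Conversely, the term with the acceleration is affine in \<open>s\<close>, so the
  second derivative of \<open>G\<close> at any \<open>s\<close> depends on the curve \<open>y\<close> only through its velocity. Hence
  \<open>B3\<close>, which requires \<open>y\<close> to be a \<open>b\<close>-segment seen from \<open>x s\<close>, gives convexity of \<open>G\<close> on the
  whole segment although \<open>y\<close> is a \<open>b\<close>-segment only from \<open>x 0\<close> (\<open>B3_imp_hess_nonneg\<close>). The first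
  derivative of \<open>G\<close> at \<open>0\<close> vanishes because \<open>D\<^sub>xb(x 0, y t)\<close> is affine in \<open>t\<close>, so \<open>G 1 \<ge> G 0\<close>,
  and this is the convexity sought (\<open>B3_imp_second_derivative_le\<close>).

  The differential arguments from \<open>B3\<close> to segment convexity take place in the open sets; segment
  convexity itself passes to the closures by compactness (\<open>segment_convexity_closure\<close>). In the other
  direction \<open>B3\<close> also speaks about curves inside the boundary, where its iterated derivatives have
  to be shown to exist. They are obtained by approximating such curves, in \<open>C\<^sup>1\<close>, by curves in the
  open sets; this is possible because the ranges of the partial gradients are convex.
\<close>

section \<open>Limits and derivatives of real curves\<close>

lemma has_vector_derivative_uniform_limit:
  fixes f :: "nat \<Rightarrow> real \<Rightarrow> 'b::banach"
  assumes "convex I" "open I"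
    and der: "\<And>n t. t \<in> I \<Longrightarrow> (f n has_vector_derivative f' n t) (at t)"
    and lim': "uniform_limit I f' g' sequentially"
    and lim: "\<And>t. t \<in> I \<Longrightarrow> (\<lambda>n. f n t) \<longlonglongrightarrow> g t"
    and t: "t \<in> I"
  shows "(g has_vector_derivative g' t) (at t)"
proof -
  have ev: "\<forall>\<^sub>F n in sequentially. \<forall>x\<in>I. \<forall>h. norm (h *\<^sub>R f' n x - h *\<^sub>R g' x) \<le> e * norm h" 
    if "e > 0" for e :: real
    using uniform_limitD[OF lim' that]
  proof eventually_elim
    case (elim n)
    have "norm (h *\<^sub>R f' n x - h *\<^sub>R g' x) \<le> e * norm h" if "x \<in> I" for x h
    proof -
      have "norm (h *\<^sub>R f' n x - h *\<^sub>R g' x) = norm (f' n x - g' x) * norm h"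
        by (simp flip: scaleR_diff_right)
      also have "\<dots> \<le> e * norm h"
        using elim that by (intro mult_right_mono) (auto simp: dist_norm intro: less_imp_le)
      finally show ?thesis .
    qed
    then show ?case by blast
  qed
  have der': "(f n has_derivative (\<lambda>h. h *\<^sub>R f' n x)) (at x within I)" if "x \<in> I" for n x
    using der[OF that] unfolding has_vector_derivative_def by (rule has_derivative_at_withinI)
  obtain G where G: "\<And>x. x \<in> I \<Longrightarrow> (\<lambda>n. f n x) \<longlonglongrightarrow> G x \<and> (G has_derivative (\<lambda>h. h *\<^sub>R g' x)) (at x within I)"
    using has_derivative_sequence[OF \<open>convex I\<close> der' ev t lim[OF t]] by blast
  have "G x = g x" if "x \<in> I" for x
    using G[OF that] lim[OF that] LIMSEQ_unique by blast
  then have "(g has_derivative (\<lambda>h. h *\<^sub>R g' t)) (at t within I)"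
    using G[OF t] by (intro has_derivative_transform[OF t, of g G]) auto
  then show ?thesis
    unfolding has_vector_derivative_def at_within_open[OF t \<open>open I\<close>] .
qed

lemma uniform_limit_Pair:
  fixes f :: "_ \<Rightarrow> _ \<Rightarrow> 'a::real_normed_vector" and g :: "_ \<Rightarrow> _ \<Rightarrow> 'c::real_normed_vector"
  assumes "uniform_limit I f f' F" "uniform_limit I g g' F"
  shows "uniform_limit I (\<lambda>n t. (f n t, g n t)) (\<lambda>t. (f' t, g' t)) F"
proof -
  have "bounded_linear (\<lambda>x::'a. (x, 0::'c))" "bounded_linear (\<lambda>y::'c. (0::'a, y))"
    by (intro bounded_linear_Pair bounded_linear_ident bounded_linear_zero)+
  then have "uniform_limit I (\<lambda>n t. (f n t, 0) + (0, g n t)) (\<lambda>t. (f' t, 0) + (0, g' t)) F"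
    by (intro uniform_limit_add bounded_linear.uniform_limit[of "\<lambda>x. (x, 0)"]
        bounded_linear.uniform_limit[of "\<lambda>y. (0, y)"] assms)
  then show ?thesis by simp
qed

lemma uniform_limit_pointwise_const:
  assumes "a \<longlonglongrightarrow> l"
  shows "uniform_limit I (\<lambda>n t. a n) (\<lambda>t. l) sequentially"
  using assms by (auto simp: uniform_limit_iff tendsto_iff elim: eventually_mono)

lemma uniform_limit_sum:
  fixes f :: "'i \<Rightarrow> 'a \<Rightarrow> 'b \<Rightarrow> 'c::real_normed_vector"
  assumes "\<And>i. i \<in> A \<Longrightarrow> uniform_limit S (f i) (l i) F"
  shows "uniform_limit S (\<lambda>n t. \<Sum>i\<in>A. f i n t) (\<lambda>t. \<Sum>i\<in>A. l i t) F"
  using assms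
  by (induction A rule: infinite_finite_induct) (auto intro!: uniform_limit_intros)

lemma has_vector_derivative_iff_difference_quotient:
  fixes f :: "real \<Rightarrow> 'b::real_normed_vector"
  shows "(f has_vector_derivative D) (at t) \<longleftrightarrow> ((\<lambda>s. (f s - f t) /\<^sub>R (s - t)) \<longlongrightarrow> D) (at t)"
proof -
  have "norm ((f s - f t) - (s - t) *\<^sub>R D) / norm (s - t) = norm ((f s - f t) /\<^sub>R (s - t) - D)"
    if "s \<noteq> t" for s
  proof -
    have "(f s - f t) /\<^sub>R (s - t) - D = ((f s - f t) - (s - t) *\<^sub>R D) /\<^sub>R (s - t)"
      using that by (simp add: scaleR_diff_right[of "inverse (s - t)"])
    then show ?thesis by (simp add: divide_inverse mult.commute)
  qed
  then have "((\<lambda>s. norm ((f s - f t) - (s - t) *\<^sub>R D) / norm (s - t)) \<longlongrightarrow> 0) (at t) \<longleftrightarrow>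
        ((\<lambda>s. norm ((f s - f t) /\<^sub>R (s - t) - D)) \<longlongrightarrow> 0) (at t)"
    by (intro filterlim_cong) (auto simp: eventually_at_filter)
  then show ?thesis
    unfolding has_vector_derivative_def has_derivative_iff_norm
    by (simp add: bounded_linear_scaleR_left tendsto_norm_zero_iff LIM_zero_iff)
qed

lemma deriv2I:
  fixes f :: "real \<Rightarrow> real"
  assumes "open I" "t \<in> I"
    and f': "\<And>s. s \<in> I \<Longrightarrow> (f has_real_derivative f' s) (at s)"
    and f'': "(f' has_real_derivative l) (at t)"
  shows "(deriv ^^ 2) f t = l"
proof -
  have "(deriv f has_real_derivative l) (at t)"
    by (rule has_field_derivative_transform_within_open[OF f'' assms(1,2)])
       (use DERIV_imp_deriv[OF f'] in auto)
  then show ?thesis by (simp add: numeral_2_eq_2 DERIV_imp_deriv)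
qed

text \<open>The midpoint inequality says that \<open>t \<mapsto> g t + g (- t)\<close>, which has a critical point at \<open>0\<close>, has a
  minimum there. It is implied both by convexity of \<open>g\<close> and by minimality of \<open>g\<close> at \<open>0\<close>.\<close>

lemma second_derivative_nonneg:
  fixes g :: "real \<Rightarrow> real"
  assumes "r > 0"
    and g': "\<And>t. \<bar>t\<bar> < r \<Longrightarrow> (g has_real_derivative g' t) (at t)"
    and g'': "(g' has_real_derivative l) (at 0)"
    and mid: "\<And>t. \<bar>t\<bar> < r \<Longrightarrow> 2 * g 0 \<le> g t + g (- t)"
  shows "l \<ge> 0"
proof (rule ccontr)
  assume "\<not> l \<ge> 0"
  define \<phi> where "\<phi> t = g t + g (- t)" for t
  define \<phi>' where "\<phi>' t = g' t - g' (- t)" for t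
  have \<phi>': "(\<phi> has_real_derivative \<phi>' t) (at t)" if "\<bar>t\<bar> < r" for t
    unfolding \<phi>_def \<phi>'_def
    using DERIV_add[OF g'[OF that] DERIV_chain2[OF g'[of "- t"] DERIV_minus[OF DERIV_ident]]] that
    by simp
  have "(\<phi>' has_real_derivative 2 * l) (at 0)"
    unfolding \<phi>'_def
    using DERIV_diff[OF g'' DERIV_chain2[where f=g' and g=uminus and x=0, OF _ DERIV_minus[OF DERIV_ident], of l]] g''
    by simp
  from DERIV_neg_dec_right[OF this] \<open>\<not> l \<ge> 0\<close>
  obtain d where d: "d > 0" "\<And>h. 0 < h \<Longrightarrow> h < d \<Longrightarrow> \<phi>' h < \<phi>' 0" by auto
  define h where "h = min d r / 2"
  have h: "0 < h" "h < d" "h < r" using d \<open>r > 0\<close> by (auto simp: h_def)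
  have "\<exists>z>0. z < h \<and> \<phi> h - \<phi> 0 = (h - 0) * \<phi>' z"
    by (rule MVT2[OF h(1)]) (use \<phi>' h in auto)
  then obtain z where z: "0 < z" "z < h" "\<phi> h - \<phi> 0 = h * \<phi>' z" by auto
  have "\<phi>' z < 0" using d(2)[of z] z h by (simp add: \<phi>'_def)
  then have "\<phi> h < \<phi> 0" using z h by (simp add: mult_pos_neg algebra_simps)
  then show False using mid[of h] h by (simp add: \<phi>_def)
qed

section \<open>Jets that extend continuously to the closure\<close>

lemma continuous_eq_on_closure:
  fixes f g :: "'a::metric_space \<Rightarrow> 'b::metric_space"
  assumes "continuous_on (closure S) f" "continuous_on (closure S) g"
    and "\<And>x. x \<in> S \<Longrightarrow> f x = g x" and z: "z \<in> closure S"
  shows "f z = g z"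
proof -
  have "continuous_on (closure S) (\<lambda>x. dist (f x) (g x))"
    using assms by (intro continuous_intros)
  from continuous_constant_on_closure[OF this, of 0] assms(3) z show ?thesis by simp
qed

text \<open>\<open>D vs\<close> stands for the iterated directional derivative of \<open>D []\<close>, the head of the list being the
  direction of the outermost differentiation, with its continuous extension to the closure. Having
  all of them as values of one total function makes chain rules of every order instances of a
  single statement.\<close>

definition jet_on :: "nat \<Rightarrow> 'a::euclidean_space set \<Rightarrow> ('a list \<Rightarrow> 'a \<Rightarrow> real) \<Rightarrow> bool" where
  "jet_on k S D \<longleftrightarrow>
     (\<forall>vs. length vs \<le> k \<longrightarrow> continuous_on (closure S) (D vs)) \<and>
     (\<forall>vs. length vs < k \<longrightarrow> (\<forall>z\<in>S. (D vs has_derivative (\<lambda>v. D (v # vs) z)) (at z)))"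

lemma jet_on_cont: "jet_on k S D \<Longrightarrow> length vs \<le> k \<Longrightarrow> continuous_on (closure S) (D vs)"
  and jet_on_deriv: "jet_on k S D \<Longrightarrow> length vs < k \<Longrightarrow> z \<in> S \<Longrightarrow>
        (D vs has_derivative (\<lambda>v. D (v # vs) z)) (at z)"
  by (auto simp: jet_on_def)

text \<open>The recursion of \<open>extends_Ck\<close> peels off the innermost derivative, so the jet of \<open>f\<close> is assembled
  from the jets of its directional derivatives.\<close>

lemma extends_Ck_imp_jet_on:
  fixes f :: "'a::euclidean_space \<Rightarrow> real"
  assumes "extends_Ck k S f" "open S"
  obtains D where "jet_on k S D" "\<And>z. z \<in> S \<Longrightarrow> D [] z = f z"
  using assms
proof (induction k arbitrary: f thesis)
  case 0
  then obtain g where g: "continuous_on (closure S) g" "\<And>z. z \<in> S \<Longrightarrow> g z = f z" by auto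
  show ?case
    by (rule "0.prems"(1)[of "\<lambda>vs. g"]) (use g in \<open>auto simp: jet_on_def\<close>)
next
  case (Suc k)
  from Suc.prems obtain g where g: "continuous_on (closure S) g" "\<And>z. z \<in> S \<Longrightarrow> g z = f z"
    and diff: "\<And>z. z \<in> S \<Longrightarrow> f differentiable (at z)"
    and ext: "\<And>v. extends_Ck k S (\<lambda>x. frechet_derivative f (at x) v)" by auto
  have "\<exists>D. jet_on k S D \<and> (\<forall>z\<in>S. D [] z = frechet_derivative f (at z) v)" for v
    using Suc.IH[OF _ ext[of v] \<open>open S\<close>] by metis
  then obtain E where E: "\<And>v. jet_on k S (E v)"
      "\<And>v z. z \<in> S \<Longrightarrow> E v [] z = frechet_derivative f (at z) v"
    by metis
  \<comment> \<open>The innermost direction is the last entry of the list; it selects the jet of that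
     directional derivative.\<close>
  define D where "D vs = (if vs = [] then g else E (last vs) (butlast vs))" for vs
  have "continuous_on (closure S) (D vs)" if "length vs \<le> Suc k" for vs
    using that jet_on_cont[OF E(1)] g by (auto simp: D_def)
  moreover have "(D vs has_derivative (\<lambda>v. D (v # vs) z)) (at z)"
    if "length vs < Suc k" "z \<in> S" for vs z
  proof (cases "vs = []")
    case True
    have "(f has_derivative frechet_derivative f (at z)) (at z)"
      using diff that by (simp add: frechet_derivative_works)
    then have "(g has_derivative frechet_derivative f (at z)) (at z)"
      by (rule has_derivative_transform_within_open[OF _ \<open>open S\<close>]) (use that g in auto)
    moreover have "(\<lambda>v. D (v # vs) z) = frechet_derivative f (at z)"
      using True that E by (auto simp: D_def)
    ultimately show ?thesis using True by (simp add: D_def)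
  next
    case False
    then show ?thesis
      using that jet_on_deriv[OF E(1), of "butlast vs" z "last vs"]
      by (cases vs rule: rev_cases) (auto simp: D_def)
  qed
  ultimately have "jet_on (Suc k) S D" by (auto simp: jet_on_def)
  then show ?case by (rule Suc.prems(1)) (simp add: D_def g)
qed

text \<open>Linearity in the outermost direction holds in \<open>S\<close>, where the jet consists of Frechet derivatives,
  and persists on the closure by continuity.\<close>

lemma jet_on_sum_Basis:
  assumes D: "jet_on k S D" and "length vs < k" "z \<in> closure S"
  shows "D (v # vs) z = (\<Sum>i\<in>Basis. (v \<bullet> i) * D (i # vs) z)"
proof (rule continuous_eq_on_closure[OF _ _ _ \<open>z \<in> closure S\<close>])
  show "continuous_on (closure S) (D (v # vs))"
    using assms jet_on_cont[OF D, of "v # vs"] by simp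
  show "continuous_on (closure S) (\<lambda>z. \<Sum>i\<in>Basis. (v \<bullet> i) * D (i # vs) z)"
    using assms jet_on_cont[OF D, of "_ # vs"] by (intro continuous_intros) simp
next
  fix z assume "z \<in> S"
  interpret linear "\<lambda>v. D (v # vs) z"
    by (rule has_derivative_linear[OF jet_on_deriv[OF D \<open>length vs < k\<close> \<open>z \<in> S\<close>]])
  have "D (v # vs) z = D ((\<Sum>i\<in>Basis. (v \<bullet> i) *\<^sub>R i) # vs) z"
    by (simp add: euclidean_representation)
  also have "\<dots> = (\<Sum>i\<in>Basis. (v \<bullet> i) * D (i # vs) z)"
    by (simp only: sum scaleR real_scaleR_def)
  finally show "D (v # vs) z = (\<Sum>i\<in>Basis. (v \<bullet> i) * D (i # vs) z)" .
qed

lemma jet_on_linear: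
  assumes D: "jet_on k S D" and "length vs < k" "z \<in> closure S"
  shows "linear (\<lambda>v. D (v # vs) z)"
proof (rule linearI)
  fix v w c
  note sum_Basis = jet_on_sum_Basis[OF assms]
  show "D ((v + w) # vs) z = D (v # vs) z + D (w # vs) z"
    by (simp only: sum_Basis[of "v + w"] sum_Basis[of v] sum_Basis[of w] inner_add_left
        distrib_right sum.distrib)
  show "D ((c *\<^sub>R v) # vs) z = c *\<^sub>R D (v # vs) z"
    by (simp only: sum_Basis[of "c *\<^sub>R v"] sum_Basis[of v] inner_scaleR_left
        real_scaleR_def sum_distrib_left mult.assoc)
qed

text \<open>Both mixed derivatives are the limit of the same second difference quotient, by two applications
  of the mean value theorem.\<close>

lemma jet_on_Clairaut:
  assumes D: "jet_on k S D" and vs: "Suc (length vs) < k" and "open S" and z: "z \<in> S"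
  shows "D (v # w # vs) z = D (w # v # vs) z"
proof -
  define A where "A = (\<lambda>v w h. D vs (z + h *\<^sub>R v + h *\<^sub>R w) - D vs (z + h *\<^sub>R v)
                      - D vs (z + h *\<^sub>R w) + D vs z)"
  have key: "((\<lambda>h. A v w h / h\<^sup>2) \<longlongrightarrow> D (w # v # vs) z) (at_right 0)" for v w
  proof (rule tendstoI)
    fix e :: real assume "e > 0"
    have cont: "continuous_on S (D (w # v # vs))"
      using jet_on_cont[OF D, of "w # v # vs"] vs closure_subset continuous_on_subset
      by (metis Suc_leI length_Cons)
    obtain r where r: "r > 0" "ball z r \<subseteq> S" using \<open>open S\<close> z openE by blast
    obtain r' where r': "r' > 0" "\<And>y. y \<in> S \<Longrightarrow> dist y z < r' \<Longrightarrow> dist (D (w # v # vs) y) (D (w # v # vs) z) < e"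
      using cont z \<open>e > 0\<close> unfolding continuous_on_iff by meson
    define \<rho> where "\<rho> = min r r' / (norm v + norm w + 1)"
    have pos: "norm v + norm w + 1 > 0" by (smt (verit) norm_ge_zero)
    have \<rho>: "\<rho> > 0" using r r' pos by (simp add: \<rho>_def)
    have near: "dist (z + a *\<^sub>R v + c *\<^sub>R w) z < min r r'"
      if "0 \<le> a" "a \<le> h" "0 \<le> c" "c \<le> h" "h < \<rho>" for a c h
    proof -
      have "dist (z + a *\<^sub>R v + c *\<^sub>R w) z = norm (a *\<^sub>R v + c *\<^sub>R w)" by (simp add: dist_norm add.assoc)
      also have "\<dots> \<le> a * norm v + c * norm w" using norm_triangle_ineq[of "a *\<^sub>R v" "c *\<^sub>R w"] that by simp
      also have "\<dots> \<le> h * norm v + h * norm w" using that by (intro add_mono mult_right_mono) auto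
      also have "\<dots> \<le> h * (norm v + norm w + 1)" using that by (simp add: algebra_simps)
      also have "\<dots> < min r r'" using that pos by (simp add: \<rho>_def pos_less_divide_eq)
      finally show ?thesis .
    qed
    have inS: "z + a *\<^sub>R v + c *\<^sub>R w \<in> S"
      if "0 \<le> a" "a \<le> h" "0 \<le> c" "c \<le> h" "h < \<rho>" for a c h
      using near[OF that] r by (auto simp: dist_commute)
    have der: "((\<lambda>a. D us (p + a *\<^sub>R u)) has_real_derivative D (u # us) (p + a *\<^sub>R u)) (at a)"
      if "length us \<le> Suc (length vs)" "p + a *\<^sub>R u \<in> S" for us p u a
    proof -
      have *: "(D us has_derivative (\<lambda>v. D (v # us) (p + a *\<^sub>R u))) (at (p + a *\<^sub>R u) within range (\<lambda>a. p + a *\<^sub>R u))"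
        using jet_on_deriv[OF D _ that(2), of us] that vs by (simp add: has_derivative_at_withinI)
      have "((\<lambda>a. p + a *\<^sub>R u) has_vector_derivative u) (at a)"
        by (auto intro!: derivative_eq_intros)
      from vector_derivative_diff_chain_within[OF this *] 
      show ?thesis by (simp add: o_def has_real_derivative_iff_has_vector_derivative)
    qed
    have "dist (A v w h / h\<^sup>2) (D (w # v # vs) z) < e" if h: "0 < h" "h < \<rho>" for h
    proof -
      have "\<exists>a>0. a < h \<and> A v w h = (h - 0) * (D (v # vs) (z + h *\<^sub>R w + a *\<^sub>R v) - D (v # vs) (z + a *\<^sub>R v))"
      proof -
        have dd: "((\<lambda>a. D vs (z + h *\<^sub>R w + a *\<^sub>R v) - D vs (z + a *\<^sub>R v)) has_real_derivative
              D (v # vs) (z + h *\<^sub>R w + a *\<^sub>R v) - D (v # vs) (z + a *\<^sub>R v)) (at a)" if "0 \<le> a" "a \<le> h" for a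
          using inS[of a h h] inS[of a h 0] that h
          by (intro DERIV_diff der) (auto simp: add_ac)
        from MVT2[OF h(1) this] show ?thesis by (auto simp: A_def algebra_simps)
      qed
      then obtain a where a: "0 < a" "a < h"
        "A v w h = h * (D (v # vs) (z + a *\<^sub>R v + h *\<^sub>R w) - D (v # vs) (z + a *\<^sub>R v))"
        by (auto simp: add_ac)
      have "\<exists>c>0. c < h \<and> D (v # vs) (z + a *\<^sub>R v + h *\<^sub>R w) - D (v # vs) (z + a *\<^sub>R v + 0 *\<^sub>R w)
              = (h - 0) * D (w # v # vs) (z + a *\<^sub>R v + c *\<^sub>R w)"
        by (rule MVT2[OF h(1)], rule der) (use inS[of a h] a h in auto)
      then obtain c where c: "0 < c" "c < h"
        "D (v # vs) (z + a *\<^sub>R v + h *\<^sub>R w) - D (v # vs) (z + a *\<^sub>R v) = h * D (w # v # vs) (z + a *\<^sub>R v + c *\<^sub>R w)"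
        by auto
      have "A v w h / h\<^sup>2 = D (w # v # vs) (z + a *\<^sub>R v + c *\<^sub>R w)"
        using a c h by (simp add: power2_eq_square)
      then show ?thesis
        using r'(2)[OF inS[of a h c]] near[of a h c] a c h by simp
    qed
    then show "\<forall>\<^sub>F h in at_right 0. dist (A v w h / h\<^sup>2) (D (w # v # vs) z) < e"
      unfolding eventually_at_right_field using \<rho> by auto
  qed
  have "A v w h = A w v h" for h by (simp add: A_def add_ac)
  then have "((\<lambda>h. A v w h / h\<^sup>2) \<longlongrightarrow> D (v # w # vs) z) (at_right 0)"
    using key[of w v] by simp
  then show ?thesis
    by (rule tendsto_unique[OF trivial_limit_at_right_real _ key])
qed

lemma jet_on_cong_Cons:
  assumes D: "jet_on k S D" and "open S" "z \<in> S" "length us < k" "length vs < k"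
    and eq: "\<And>z. z \<in> S \<Longrightarrow> D us z = D vs z"
  shows "D (w # us) z = D (w # vs) z"
proof -
  have "(D vs has_derivative (\<lambda>w. D (w # us) z)) (at z)"
    by (rule has_derivative_transform_within_open[OF jet_on_deriv[OF D \<open>length us < k\<close> \<open>z \<in> S\<close>] \<open>open S\<close> \<open>z \<in> S\<close>])
       (rule eq)
  from has_derivative_unique[OF this jet_on_deriv[OF D \<open>length vs < k\<close> \<open>z \<in> S\<close>]]
  show ?thesis by metis
qed

section \<open>Curves in the closure of an open set\<close>

text \<open>\<open>Z\<close> is a curve in the closure of \<open>S\<close> with velocity \<open>W\<close> that is a limit in \<open>C\<^sup>1\<close> of curves inside
  \<open>S\<close>. On the boundary the derivatives of a function on \<open>S\<close> exist only as continuous extensions;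
  such an approximation is what transports the chain rule there.\<close>

definition inner_C1_curve ::
  "'a::euclidean_space set \<Rightarrow> real set \<Rightarrow> (real \<Rightarrow> 'a) \<Rightarrow> (real \<Rightarrow> 'a) \<Rightarrow> bool" where
  "inner_C1_curve S I Z W \<longleftrightarrow> open I \<and> convex I \<and> bounded (W ` I) \<and>
     (\<exists>Zn Wn. (\<forall>n. \<forall>t\<in>I. Zn n t \<in> S \<and> (Zn n has_vector_derivative Wn n t) (at t)) \<and>
        uniform_limit I Zn Z sequentially \<and> uniform_limit I Wn W sequentially)"

lemma inner_C1_curve_closure:
  assumes "inner_C1_curve S I Z W" "t \<in> I"
  shows "Z t \<in> closure S"
proof -
  from assms obtain Zn where "\<forall>n. Zn n t \<in> S" and lim: "uniform_limit I Zn Z sequentially"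
    unfolding inner_C1_curve_def by auto
  moreover have "(\<lambda>n. Zn n t) \<longlonglongrightarrow> Z t" by (rule tendsto_uniform_limitI[OF lim \<open>t \<in> I\<close>])
  ultimately show ?thesis unfolding closure_sequential by (intro exI[of _ "\<lambda>n. Zn n t"]) simp
qed

lemma inner_C1_curve_cong:
  assumes "inner_C1_curve S I Z W" "\<And>t. t \<in> I \<Longrightarrow> Z t = Z' t"
  shows "inner_C1_curve S I Z' W"
proof -
  have "uniform_limit I Zn Z sequentially \<longleftrightarrow> uniform_limit I Zn Z' sequentially" for Zn
    by (rule uniform_limit_cong') (use assms(2) in auto)
  then show ?thesis using assms(1) by (simp add: inner_C1_curve_def)
qed

lemma inner_C1_curve_Pair_left:
  fixes S :: "'a::euclidean_space set" and T :: "'b::euclidean_space set"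
  assumes Z: "inner_C1_curve S I Z W" and y: "y \<in> closure T"
  shows "inner_C1_curve (S \<times> T) I (\<lambda>t. (Z t, y)) (\<lambda>t. (W t, 0))"
proof -
  from Z obtain Zn Wn
    where Zn: "\<forall>n. \<forall>t\<in>I. Zn n t \<in> S \<and> (Zn n has_vector_derivative Wn n t) (at t)"
      and lim: "uniform_limit I Zn Z sequentially" "uniform_limit I Wn W sequentially"
    unfolding inner_C1_curve_def by auto
  from y obtain yn where yn: "\<forall>n. yn n \<in> T" "yn \<longlonglongrightarrow> y" by (auto simp: closure_sequential)
  have "bounded (W ` I)" using Z by (simp add: inner_C1_curve_def)
  then have "bounded ((\<lambda>w. (w, 0::'b)) ` W ` I)"
    by (rule bounded_linear_image[OF _ bounded_linear_Pair]) (rule bounded_linear_ident bounded_linear_zero)+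
  moreover have "((\<lambda>t. (Zn n t, yn n)) has_vector_derivative (Wn n t, 0::'b)) (at t)" if "t \<in> I" for n t
    using Zn that by (intro has_vector_derivative_Pair has_vector_derivative_const) auto
  moreover have "uniform_limit I (\<lambda>n t. (Zn n t, yn n)) (\<lambda>t. (Z t, y)) sequentially"
    by (intro uniform_limit_Pair lim uniform_limit_pointwise_const yn)
  moreover have "uniform_limit I (\<lambda>n t. (Wn n t, 0::'b)) (\<lambda>t. (W t, 0)) sequentially"
    by (intro uniform_limit_Pair lim uniform_limit_pointwise_const tendsto_const)
  ultimately show ?thesis
    using Z Zn yn unfolding inner_C1_curve_def image_image
    by (intro conjI exI[of _ "\<lambda>n t. (Zn n t, yn n)"] exI[of _ "\<lambda>n t. (Wn n t, 0)"]) auto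
qed

lemma inner_C1_curve_Pair_right:
  fixes S :: "'a::euclidean_space set" and T :: "'b::euclidean_space set"
  assumes Z: "inner_C1_curve T I Z W" and x: "x \<in> closure S"
  shows "inner_C1_curve (S \<times> T) I (\<lambda>t. (x, Z t)) (\<lambda>t. (0, W t))"
proof -
  from Z obtain Zn Wn
    where Zn: "\<forall>n. \<forall>t\<in>I. Zn n t \<in> T \<and> (Zn n has_vector_derivative Wn n t) (at t)"
      and lim: "uniform_limit I Zn Z sequentially" "uniform_limit I Wn W sequentially"
    unfolding inner_C1_curve_def by auto
  from x obtain xn where xn: "\<forall>n. xn n \<in> S" "xn \<longlonglongrightarrow> x" by (auto simp: closure_sequential)
  have "bounded (W ` I)" using Z by (simp add: inner_C1_curve_def)
  then have "bounded ((\<lambda>w. (0::'a, w)) ` W ` I)"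
    by (rule bounded_linear_image[OF _ bounded_linear_Pair]) (rule bounded_linear_zero bounded_linear_ident)+
  moreover have "((\<lambda>t. (xn n, Zn n t)) has_vector_derivative (0::'a, Wn n t)) (at t)" if "t \<in> I" for n t
    using Zn that by (intro has_vector_derivative_Pair has_vector_derivative_const) auto
  moreover have "uniform_limit I (\<lambda>n t. (xn n, Zn n t)) (\<lambda>t. (x, Z t)) sequentially"
    by (intro uniform_limit_Pair lim uniform_limit_pointwise_const xn)
  moreover have "uniform_limit I (\<lambda>n t. (0::'a, Wn n t)) (\<lambda>t. (0, W t)) sequentially"
    by (intro uniform_limit_Pair lim uniform_limit_pointwise_const tendsto_const)
  ultimately show ?thesis
    using Z Zn xn unfolding inner_C1_curve_def image_image
    by (intro conjI exI[of _ "\<lambda>n t. (xn n, Zn n t)"] exI[of _ "\<lambda>n t. (0, Wn n t)"]) auto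
qed

text \<open>The chain rule holds along the approximating curves, and the derivatives converge uniformly
  because \<open>D (i # vs)\<close> is uniformly continuous on the compact closure of \<open>S\<close>.\<close>

lemma jet_on_chain_rule:
  assumes D: "jet_on k S D" and vs: "length vs < k" and "bounded S"
    and Z: "inner_C1_curve S I Z W" and t: "t \<in> I"
  shows "((\<lambda>t. D vs (Z t)) has_vector_derivative D (W t # vs) (Z t)) (at t)"
proof -
  from Z have I: "open I" "convex I" and bW: "bounded (W ` I)"
    by (auto simp: inner_C1_curve_def)
  from Z obtain Zn Wn
    where Zn: "\<forall>n. \<forall>t\<in>I. Zn n t \<in> S \<and> (Zn n has_vector_derivative Wn n t) (at t)"
      and limZ: "uniform_limit I Zn Z sequentially" and limW: "uniform_limit I Wn W sequentially"
    unfolding inner_C1_curve_def by auto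
  from Zn have ZnS: "\<And>n t. t \<in> I \<Longrightarrow> Zn n t \<in> S"
    and Znd: "\<And>n t. t \<in> I \<Longrightarrow> (Zn n has_vector_derivative Wn n t) (at t)"
    by auto
  have ZnC: "Zn n t \<in> closure S" if "t \<in> I" for n t using ZnS[OF that] closure_subset by blast
  have ZC: "Z t \<in> closure S" if "t \<in> I" for t using inner_C1_curve_closure[OF Z that] .
  have K: "compact (closure S)" using \<open>bounded S\<close> by simp
  have lim: "uniform_limit I (\<lambda>n t. D us (Zn n t)) (\<lambda>t. D us (Z t)) sequentially"
    if "length us \<le> k" for us
    by (rule uniform_limit_compose_uniformly_continuous_on[OF limZ
          compact_uniformly_continuous[OF jet_on_cont[OF D that] K]])
       (use ZnC in auto)
  have bd: "bounded ((\<lambda>t. D us (Z t)) ` I)" if "length us \<le> k" for us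
  proof (rule bounded_subset)
    show "bounded (D us ` closure S)"
      by (intro compact_imp_bounded compact_continuous_image jet_on_cont[OF D that] K)
  qed (use ZC in auto)
  have bWi: "bounded ((\<lambda>t. W t \<bullet> i) ` I)" for i
    using bounded_linear_image[OF bW bounded_linear_inner_left[of i]] by (simp add: image_image)
  have limWi: "uniform_limit I (\<lambda>n t. Wn n t \<bullet> i) (\<lambda>t. W t \<bullet> i) sequentially" for i
    by (rule bounded_linear.uniform_limit[OF bounded_linear_inner_left limW])
  have eqn: "D (Wn n t # vs) (Zn n t) = (\<Sum>i\<in>Basis. (Wn n t \<bullet> i) * D (i # vs) (Zn n t))"
    if "t \<in> I" for n t by (rule jet_on_sum_Basis[OF D vs ZnC[OF that]])
  have eq: "D (W t # vs) (Z t) = (\<Sum>i\<in>Basis. (W t \<bullet> i) * D (i # vs) (Z t))"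
    if "t \<in> I" for t by (rule jet_on_sum_Basis[OF D vs ZC[OF that]])
  have *: "uniform_limit I (\<lambda>n t. \<Sum>i\<in>Basis. (Wn n t \<bullet> i) * D (i # vs) (Zn n t))
          (\<lambda>t. \<Sum>i\<in>Basis. (W t \<bullet> i) * D (i # vs) (Z t)) sequentially"
    using vs by (intro uniform_limit_sum uniform_lim_mult lim bd bWi limWi) auto
  have lim': "uniform_limit I (\<lambda>n t. D (Wn n t # vs) (Zn n t)) (\<lambda>t. D (W t # vs) (Z t)) sequentially"
    by (rule uniform_limit_cong'[THEN iffD2, OF eqn eq *])
  show ?thesis
  proof (rule has_vector_derivative_uniform_limit[OF I(2,1) _ lim' _ t])
    show "((\<lambda>t. D vs (Zn n t)) has_vector_derivative D (Wn n t # vs) (Zn n t)) (at t)"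
      if "t \<in> I" for n t
    proof -
      have "(D vs has_derivative (\<lambda>v. D (v # vs) (Zn n t))) (at (Zn n t) within Zn n ` UNIV)"
        using jet_on_deriv[OF D vs ZnS[OF that]] by (rule has_derivative_at_withinI)
      from vector_derivative_diff_chain_within[OF Znd[OF that] this]
      show ?thesis by (simp add: o_def)
    qed
    show "(\<lambda>n. D vs (Zn n t)) \<longlonglongrightarrow> D vs (Z t)" if "t \<in> I" for t
      by (rule tendsto_uniform_limitI[OF lim that]) (use vs in simp)
  qed
qed

text \<open>The second directional derivative in direction \<open>v\<close>, written out in coordinates: the chain rule
  applies to the jet in fixed directions \<open>i\<close>, whereas the velocity of a curve varies.\<close>

definition hess :: "('a::euclidean_space list \<Rightarrow> 'a \<Rightarrow> real) \<Rightarrow> 'a list \<Rightarrow> 'a \<Rightarrow> 'a \<Rightarrow> real" where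
  "hess D vs v z = (\<Sum>i\<in>Basis. \<Sum>j\<in>Basis. (v \<bullet> i) * (v \<bullet> j) * D (j # i # vs) z)"

lemma jet_on_second_derivative:
  assumes D: "jet_on k S D" and vs: "Suc (length vs) < k" and "bounded S"
    and Z: "inner_C1_curve S I Z W" and t: "t \<in> I"
    and W: "(W has_vector_derivative U) (at t)"
  shows "((\<lambda>t. D (W t # vs) (Z t)) has_vector_derivative D (U # vs) (Z t) + hess D vs (W t) (Z t)) (at t)"
proof -
  have I: "open I" using Z by (simp add: inner_C1_curve_def)
  have Zt: "Z t \<in> closure S" using inner_C1_curve_closure[OF Z t] .
  have Wi: "((\<lambda>t. W t \<bullet> i) has_vector_derivative U \<bullet> i) (at t)" for i
    by (rule bounded_linear.has_vector_derivative[OF bounded_linear_inner_left W])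
  have "((\<lambda>t. \<Sum>i\<in>Basis. (W t \<bullet> i) * D (i # vs) (Z t)) has_vector_derivative
         (\<Sum>i\<in>Basis. (W t \<bullet> i) * D (W t # i # vs) (Z t) + (U \<bullet> i) * D (i # vs) (Z t))) (at t)"
    by (intro has_vector_derivative_sum has_vector_derivative_mult Wi jet_on_chain_rule[OF D _ \<open>bounded S\<close> Z t])
       (use vs in auto)
  also have "(\<Sum>i\<in>Basis. (W t \<bullet> i) * D (W t # i # vs) (Z t) + (U \<bullet> i) * D (i # vs) (Z t))
      = D (U # vs) (Z t) + hess D vs (W t) (Z t)"
  proof -
    have "D (W t # i # vs) (Z t) = (\<Sum>j\<in>Basis. (W t \<bullet> j) * D (j # i # vs) (Z t))" for i
      by (rule jet_on_sum_Basis[OF D _ Zt]) (use vs in simp)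
    moreover have "D (U # vs) (Z t) = (\<Sum>i\<in>Basis. (U \<bullet> i) * D (i # vs) (Z t))"
      by (rule jet_on_sum_Basis[OF D _ Zt]) (use vs in simp)
    ultimately show ?thesis
      by (simp add: hess_def sum.distrib sum_distrib_left mult_ac)
  qed
  finally have *: "((\<lambda>t. \<Sum>i\<in>Basis. (W t \<bullet> i) * D (i # vs) (Z t)) has_vector_derivative
       D (U # vs) (Z t) + hess D vs (W t) (Z t)) (at t)" .
  have vs': "length vs < k" using vs by simp
  show ?thesis
    by (rule has_vector_derivative_transform_within_open[OF * I t])
       (rule jet_on_sum_Basis[OF D vs' inner_C1_curve_closure[OF Z], symmetric])
qed

lemma hess_scale: "hess D vs (c *\<^sub>R v) z = c\<^sup>2 * hess D vs v z"
  by (simp add: hess_def sum_distrib_left power2_eq_square mult_ac)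

section \<open>Preimages of segments under a diffeomorphism\<close>

text \<open>\<open>L e\<close> is the directional derivative of the inverse \<open>g\<close> in direction \<open>e\<close>, extended to the closure.
  It is expanded in the basis because only the extensions for the individual directions are given;
  this makes it linear in \<open>e\<close> on the closure as well.\<close>

lemma diffeo_onto_range_inverse:
  fixes F :: "'a::euclidean_space \<Rightarrow> 'a"
  assumes "open S" "bounded S" and F: "diffeo_onto_range S F"
  obtains g L where "homeomorphism (closure S) (F ` closure S) F g"
    and "closure (F ` S) = F ` closure S" and "open (F ` S)"
    and "\<And>e. continuous_on (F ` closure S) (L e)"
    and "\<And>p. p \<in> F ` S \<Longrightarrow> (g has_derivative (\<lambda>e. L e p)) (at p)"
    and "\<And>e p. L e p = (\<Sum>i\<in>Basis. (e \<bullet> i) *\<^sub>R L i p)"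
proof -
  from F obtain g where g: "homeomorphism (closure S) (F ` closure S) F g"
    and Fd: "Ck_closure 1 S F" and gd: "Ck_closure 1 (F ` S) g"
    by (auto simp: diffeo_onto_range_def)
  have contF: "continuous_on (closure S) F" and inj: "inj_on F (closure S)"
    using g by (auto simp: homeomorphism_def intro: inj_on_inverseI)
  have "compact (F ` closure S)"
    using \<open>bounded S\<close> by (intro compact_continuous_image contF) simp
  then have cl: "closure (F ` S) = F ` closure S"
    using continuous_image_closure_subset[OF contF] closure_subset[of S]
    by (intro antisym closure_minimal) (auto intro: compact_imp_closed)
  have op: "open (F ` S)"
    using continuous_on_subset[OF contF closure_subset] \<open>open S\<close> inj_on_subset[OF inj closure_subset]
    by (rule invariance_of_domain)
  have diff: "\<And>p. p \<in> F ` S \<Longrightarrow> g differentiable (at p)"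
    and ext: "\<forall>v. \<exists>h. continuous_on (closure (F ` S)) h \<and> (\<forall>p\<in>F ` S. h p = frechet_derivative g (at p) v)"
    using gd by (auto simp: Ck_closure_def)
  from ext obtain h where h: "\<And>v. continuous_on (closure (F ` S)) (h v)"
    "\<And>v p. p \<in> F ` S \<Longrightarrow> h v p = frechet_derivative g (at p) v" by metis
  define L where "L e p = (\<Sum>i\<in>Basis. (e \<bullet> i) *\<^sub>R h i p)" for e p
  have Lh: "L i p = h i p" if "i \<in> Basis" for i p
    using that by (simp add: L_def inner_Basis if_distrib[of "\<lambda>c. c *\<^sub>R _"] cong: if_cong)
  show thesis
  proof (rule that[of g L])
    show "continuous_on (F ` closure S) (L e)" for e
      unfolding L_def by (intro continuous_intros) (use h(1) cl in auto)
    show "(g has_derivative (\<lambda>e. L e p)) (at p)" if "p \<in> F ` S" for p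
    proof -
      have *: "(g has_derivative frechet_derivative g (at p)) (at p)"
        using diff[OF that] by (simp add: frechet_derivative_works)
      interpret linear "frechet_derivative g (at p)" by (rule has_derivative_linear[OF *])
      have "L e p = frechet_derivative g (at p) e" for e
      proof -
        have "L e p = frechet_derivative g (at p) (\<Sum>i\<in>Basis. (e \<bullet> i) *\<^sub>R i)"
          by (simp only: L_def h(2)[OF that] sum scaleR)
        then show ?thesis by (simp only: euclidean_representation)
      qed
      with * show ?thesis by presburger
    qed
    show "L e p = (\<Sum>i\<in>Basis. (e \<bullet> i) *\<^sub>R L i p)" for e p
      by (simp add: Lh) (simp add: L_def)
  qed (use g cl op in auto)
qed

text \<open>The approximating curves are the preimages of copies of the segment contracted towards an interior
  point of the convex range.\<close>

lemma inverse_segment_inner_C1_curve: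
  fixes F :: "'a::euclidean_space \<Rightarrow> 'a"
  assumes "bounded S" and g: "homeomorphism (closure S) (F ` closure S) F g"
    and cl: "closure (F ` S) = F ` closure S" and op: "open (F ` S)" and cvx: "convex (F ` S)"
    and L: "\<And>e. continuous_on (F ` closure S) (L e)"
    and g': "\<And>p. p \<in> F ` S \<Longrightarrow> (g has_derivative (\<lambda>e. L e p)) (at p)"
    and seg: "\<And>t. t \<in> {a<..<b} \<Longrightarrow> p + t *\<^sub>R d \<in> F ` closure S"
  shows "inner_C1_curve S {a<..<b} (\<lambda>t. g (p + t *\<^sub>R d)) (\<lambda>t. L d (p + t *\<^sub>R d))"
proof (cases "{a<..<b} = {}")
  case True
  then show ?thesis by (simp only: inner_C1_curve_def) simp
next
  case False
  let ?I = "{a<..<b}"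
  have contF: "continuous_on (closure S) F" and contg: "continuous_on (F ` closure S) g"
    using g by (auto simp: homeomorphism_def)
  have K: "compact (F ` closure S)"
    using \<open>bounded S\<close> by (intro compact_continuous_image contF) simp
  from False obtain t0 where "t0 \<in> ?I" by (meson ex_in_conv)
  from seg[OF this] have "closure (F ` S) \<noteq> {}" unfolding cl by (metis empty_iff)
  then obtain c where c: "c \<in> F ` S" by (metis closure_empty ex_in_conv)
  \<comment> \<open>Shrinking the segment towards an interior point of the range pushes it inside.\<close>
  define e where "e n = 1 / real (Suc n)" for n
  have e: "0 < e n" "e n \<le> 1" for n by (auto simp: e_def)
  have e0: "e \<longlonglongrightarrow> 0"
    unfolding e_def using LIMSEQ_inverse_real_of_nat by (simp add: inverse_eq_divide)
  define q where "q n t = (p + t *\<^sub>R d) - e n *\<^sub>R (p + t *\<^sub>R d - c)" for n t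
  have q: "q n t \<in> F ` S" if "t \<in> ?I" for n t
    using mem_interior_closure_convex_shrink[OF cvx _ _ e, of c "p + t *\<^sub>R d"] c op seg[OF that] cl
    by (auto simp: q_def interior_open)
  then have qc: "q n t \<in> F ` closure S" if "t \<in> ?I" for n t
    using that closure_subset by blast
  obtain M where M: "\<And>x. x \<in> F ` closure S \<Longrightarrow> norm (x - c) \<le> M"
  proof -
    have "bounded ((\<lambda>x. x - c) ` F ` closure S)"
      using compact_imp_bounded[OF K] by (rule bounded_translation_minus)
    then show thesis using that by (auto simp: bounded_iff)
  qed
  have qlim: "uniform_limit ?I q (\<lambda>t. p + t *\<^sub>R d) sequentially"
  proof (rule uniform_limitI)
    fix r :: real assume "r > 0"
    have "(\<lambda>n. e n * M) \<longlonglongrightarrow> 0 * M" by (intro tendsto_intros e0)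
    then have "\<forall>\<^sub>F n in sequentially. e n * M < r"
      using \<open>r > 0\<close> by (simp add: order_tendstoD)
    then show "\<forall>\<^sub>F n in sequentially. \<forall>t\<in>?I. dist (q n t) (p + t *\<^sub>R d) < r"
    proof eventually_elim
      case (elim n)
      show ?case
      proof
        fix t assume t: "t \<in> ?I"
        have "dist (q n t) (p + t *\<^sub>R d) = e n * norm (p + t *\<^sub>R d - c)"
          using e(1)[of n] by (simp add: q_def dist_norm)
        also have "\<dots> \<le> e n * M" using e(1)[of n] M[OF seg[OF t]] by (intro mult_left_mono) auto
        finally show "dist (q n t) (p + t *\<^sub>R d) < r" using elim by simp
      qed
    qed
  qed
  have comp: "uniform_limit ?I (\<lambda>n t. f (q n t)) (\<lambda>t. f (p + t *\<^sub>R d)) sequentially"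
    if "continuous_on (F ` closure S) f" for f :: "'a \<Rightarrow> 'a"
    by (rule uniform_limit_compose_uniformly_continuous_on[OF qlim compact_uniformly_continuous[OF that K]])
       (use qc K compact_imp_closed in auto)
  have bd: "bounded ((\<lambda>t. L d (p + t *\<^sub>R d)) ` ?I)"
    by (rule bounded_subset[OF compact_imp_bounded[OF compact_continuous_image[OF L K]]])
       (use seg in auto)
  have lim_shrunk: "uniform_limit ?I (\<lambda>n t. (1 - e n) *\<^sub>R L d (q n t)) (\<lambda>t. L d (p + t *\<^sub>R d)) sequentially"
  proof -
    have "uniform_limit ?I (\<lambda>n t. 1 - e n) (\<lambda>t. 1) sequentially"
    proof (rule uniform_limitI)
      fix r :: real assume "r > 0"
      then have "\<forall>\<^sub>F n in sequentially. e n < r" using order_tendstoD(2)[OF e0] by simp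
      then show "\<forall>\<^sub>F n in sequentially. \<forall>t\<in>?I. dist (1 - e n) 1 < r"
        by eventually_elim (use e(1) in \<open>auto simp: dist_norm less_imp_le\<close>)
    qed
    from bounded_bilinear.bounded_uniform_limit[OF bounded_bilinear_scaleR this comp[OF L] bd]
    show ?thesis by (simp add: image_constant_conv)
  qed
  have der: "((\<lambda>t. g (q n t)) has_vector_derivative (1 - e n) *\<^sub>R L d (q n t)) (at t)" if "t \<in> ?I" for n t
  proof -
    have "(q n has_vector_derivative (1 - e n) *\<^sub>R d) (at t)"
      unfolding q_def by (auto intro!: derivative_eq_intros simp: algebra_simps)
    moreover have D: "(g has_derivative (\<lambda>e. L e (q n t))) (at (q n t))" by (rule g'[OF q[OF that]])
    then have "(g has_derivative (\<lambda>e. L e (q n t))) (at (q n t) within range (q n))"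
      by (rule has_derivative_at_withinI)
    ultimately have "(g \<circ> q n has_vector_derivative L ((1 - e n) *\<^sub>R d) (q n t)) (at t)"
      by (rule vector_derivative_diff_chain_within)
    moreover have "L ((1 - e n) *\<^sub>R d) (q n t) = (1 - e n) *\<^sub>R L d (q n t)"
      using linear_scale[OF has_derivative_linear[OF D]] .
    ultimately show ?thesis by (simp add: o_def)
  qed
  have gS: "g (q n t) \<in> S" if "t \<in> ?I" for n t
  proof -
    from q[OF that] obtain y where "y \<in> S" "q n t = F y" by auto
    moreover have "y \<in> closure S" using \<open>y \<in> S\<close> closure_subset by blast
    ultimately show ?thesis using g by (simp add: homeomorphism_def)
  qed
  show ?thesis
    unfolding inner_C1_curve_def
    by (intro conjI exI[of _ "\<lambda>n t. g (q n t)"] exI[of _ "\<lambda>n t. (1 - e n) *\<^sub>R L d (q n t)"]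
        allI ballI der gS lim_shrunk comp contg bd) auto
qed

text \<open>\<open>A z\<close> plays the role of the derivative of \<open>F\<close> at \<open>z\<close>, up to the boundary. Differentiating
  \<open>F (g q) = q\<close> shows that \<open>A z\<close> is invertible with the extended derivative of the inverse \<open>g\<close> as
  inverse. The velocity \<open>W\<close> then solves \<open>A (y t) (W t) = d\<close>, and a solution of a linear
  equation with differentiable, boundedly invertible coefficients is differentiable.\<close>

lemma segment_curve_twice_differentiable:
  fixes F :: "'a::euclidean_space \<Rightarrow> 'a" and A :: "'a \<Rightarrow> 'a \<Rightarrow> 'a"
  assumes S: "open S" "bounded S" and F: "diffeo_onto_range S F" and cvx: "convex (F ` S)"
    and lin: "\<And>z. z \<in> closure S \<Longrightarrow> linear (A z)"
    and contA: "\<And>v. continuous_on (closure S) (\<lambda>z. A z v)"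
    and chain: "\<And>I Z W t. inner_C1_curve S I Z W \<Longrightarrow> t \<in> I \<Longrightarrow>
          ((\<lambda>t. F (Z t)) has_vector_derivative A (Z t) (W t)) (at t)"
    and chainA: "\<And>I Z W t v. inner_C1_curve S I Z W \<Longrightarrow> t \<in> I \<Longrightarrow>
          \<exists>u. ((\<lambda>t. A (Z t) v) has_vector_derivative u) (at t)"
    and y: "\<And>t. t \<in> {a<..<b} \<Longrightarrow> y t \<in> closure S"
    and seg: "\<And>t. t \<in> {a<..<b} \<Longrightarrow> F (y t) = p + t *\<^sub>R d"
  shows "\<exists>W U. inner_C1_curve S {a<..<b} y W \<and>
      (\<forall>t\<in>{a<..<b}. (W has_vector_derivative U t) (at t) \<and> A (y t) (W t) = d) \<and>
      (\<forall>z\<in>closure S. inj (A z))"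
proof -
  obtain g L where g: "homeomorphism (closure S) (F ` closure S) F g"
    and cl: "closure (F ` S) = F ` closure S" and op: "open (F ` S)"
    and L: "\<And>e. continuous_on (F ` closure S) (L e)"
    and g': "\<And>p. p \<in> F ` S \<Longrightarrow> (g has_derivative (\<lambda>e. L e p)) (at p)"
    and Lsum: "\<And>e p. L e p = (\<Sum>i\<in>Basis. (e \<bullet> i) *\<^sub>R L i p)"
    by (rule diffeo_onto_range_inverse[OF S F]) metis
  have curve: "inner_C1_curve S {a<..<b} (\<lambda>t. g (p + t *\<^sub>R d)) (\<lambda>t. L d (p + t *\<^sub>R d))"
    if "\<And>t. t \<in> {a<..<b} \<Longrightarrow> p + t *\<^sub>R d \<in> F ` closure S" for a b p d
    by (rule inverse_segment_inner_C1_curve[OF S(2) g cl op cvx L g' that])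
  have contF: "continuous_on (closure S) F" and contg: "continuous_on (F ` closure S) g"
    using g by (auto simp: homeomorphism_def)
  have gF: "g (F z) = z" if "z \<in> closure S" for z using g that by (auto simp: homeomorphism_def)
  have Fg: "F (g q) = q" if "q \<in> F ` closure S" for q using g that by (auto simp: homeomorphism_def)
  have gcl: "g q \<in> closure S" if "q \<in> F ` closure S" for q using g that by (auto simp: homeomorphism_def)
  have Asum: "A z v = (\<Sum>i\<in>Basis. (v \<bullet> i) *\<^sub>R A z i)" if "z \<in> closure S" for z v
  proof -
    have "A z (\<Sum>i\<in>Basis. (v \<bullet> i) *\<^sub>R i) = (\<Sum>i\<in>Basis. (v \<bullet> i) *\<^sub>R A z i)"
      using lin[OF that] by (simp add: linear_sum linear_scale)
    then show ?thesis by (simp only: euclidean_representation)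
  qed
  have right: "A (g q) (L e q) = e" if "q \<in> F ` closure S" for q e
  proof (rule continuous_eq_on_closure[where S="F ` S" and f="\<lambda>q. A (g q) (L e q)" and g="\<lambda>q. e"])
    show "q \<in> closure (F ` S)" using that cl by simp
    have "continuous_on (F ` closure S) (\<lambda>q. \<Sum>i\<in>Basis. (L e q \<bullet> i) *\<^sub>R A (g q) i)"
    proof (intro continuous_intros L)
      show "continuous_on (F ` closure S) (\<lambda>q. A (g q) i)" for i
        by (rule continuous_on_compose2[OF contA contg]) (use gcl in auto)
    qed
    then have "continuous_on (F ` closure S) (\<lambda>q. A (g q) (L e q))"
      by (rule continuous_on_eq) (rule Asum[OF gcl, symmetric])
    then show "continuous_on (closure (F ` S)) (\<lambda>q. A (g q) (L e q))" by (simp only: cl)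
    show "continuous_on (closure (F ` S)) (\<lambda>q. e)" by simp
    fix q assume q: "q \<in> F ` S"
    then obtain r where r: "r > 0" "ball q r \<subseteq> F ` S" using op openE by blast
    define \<delta> where "\<delta> = r / (norm e + 1)"
    have pos: "norm e + 1 > 0" by (smt (verit) norm_ge_zero)
    have \<delta>: "\<delta> > 0" using r pos by (simp add: \<delta>_def)
    have seg': "q + t *\<^sub>R e \<in> F ` closure S" if "t \<in> {-\<delta><..<\<delta>}" for t
    proof -
      have "\<bar>t\<bar> * norm e \<le> \<bar>t\<bar> * (norm e + 1)" by (intro mult_left_mono) auto
      also have "\<dots> < r" using that pos by (auto simp: \<delta>_def pos_less_divide_eq[symmetric])
      finally have "q + t *\<^sub>R e \<in> ball q r" by (simp add: dist_norm)
      then show ?thesis using r closure_subset by blast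
    qed
    have "((\<lambda>t. F (g (q + t *\<^sub>R e))) has_vector_derivative A (g (q + 0 *\<^sub>R e)) (L e (q + 0 *\<^sub>R e))) (at 0)"
      using \<delta> by (intro chain[OF curve[OF seg']]) auto
    then have "((\<lambda>t. q + t *\<^sub>R e) has_vector_derivative A (g q) (L e q)) (at 0)"
      using has_vector_derivative_transform_within_open[of "\<lambda>t. F (g (q + t *\<^sub>R e))" _ 0 "{-\<delta><..<\<delta>}"] seg' Fg \<delta>
      by simp
    moreover have "((\<lambda>t. q + t *\<^sub>R e) has_vector_derivative e) (at 0)"
      by (auto intro!: derivative_eq_intros)
    ultimately show "A (g q) (L e q) = e" by (rule vector_derivative_unique_at)
  qed
  have injA: "inj (A z)" if z: "z \<in> closure S" for z
  proof (rule linear_surj_imp_inj[OF lin[OF z]])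
    show "surj (A z)"
      by (rule surjI[of _ "\<lambda>e. L e (F z)"]) (use right[of "F z"] gF z in auto)
  qed
  have left: "L (A z v) (F z) = v" if "z \<in> closure S" for z v
    by (rule injD[OF injA[OF that]]) (use right[of "F z"] gF[OF that] that in auto)
  let ?I = "{a<..<b}"
  have segF: "p + t *\<^sub>R d \<in> F ` closure S" if "t \<in> ?I" for t
    using y[OF that] seg[OF that] by (metis imageI)
  have yg: "g (p + t *\<^sub>R d) = y t" if "t \<in> ?I" for t
    using gF[OF y[OF that]] seg[OF that] by simp
  define W where "W t = L d (p + t *\<^sub>R d)" for t
  have c: "inner_C1_curve S ?I y W"
    using inner_C1_curve_cong[OF curve[OF segF] yg] by (simp add: W_def[abs_def])
  have AW: "A (y t) (W t) = d" if "t \<in> ?I" for t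
    using right[OF segF[OF that]] yg[OF that] by (simp add: W_def)
  have "\<exists>U. (W has_vector_derivative U) (at t)" if t: "t \<in> ?I" for t
  proof -
    obtain u where u: "((\<lambda>s. A (y s) (W t)) has_vector_derivative u) (at t)"
      using chainA[OF c t] by blast
    define Q where "Q s = (A (y s) (W t) - A (y t) (W t)) /\<^sub>R (s - t)" for s
    have Q: "(Q \<longlongrightarrow> u) (at t)"
      using u unfolding has_vector_derivative_iff_difference_quotient Q_def .
    have Lc: "((\<lambda>s. L i (p + s *\<^sub>R d)) \<longlongrightarrow> L i (p + t *\<^sub>R d)) (at t)" for i
    proof -
      have "continuous_on ?I (\<lambda>s. L i (p + s *\<^sub>R d))"
        by (rule continuous_on_compose2[OF L]) (use segF in \<open>auto intro!: continuous_intros\<close>)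
      then have "isCont (\<lambda>s. L i (p + s *\<^sub>R d)) t"
        using t by (simp add: continuous_on_eq_continuous_at del: greaterThanLessThan_iff)
      then show ?thesis by (simp add: isCont_def)
    qed
    have lim: "((\<lambda>s. - (\<Sum>i\<in>Basis. (Q s \<bullet> i) *\<^sub>R L i (p + s *\<^sub>R d))) \<longlongrightarrow>
           - (\<Sum>i\<in>Basis. (u \<bullet> i) *\<^sub>R L i (p + t *\<^sub>R d))) (at t)"
      by (intro tendsto_intros Q Lc)
    \<comment> \<open>From \<open>A (y s) (W s) = d = A (y t) (W t)\<close>, the increment of \<open>W\<close> is minus the inverse of
       \<open>A (y s)\<close> applied to the increment of \<open>A (y s)\<close> at the fixed vector \<open>W t\<close>.\<close>
    have eq: "- (\<Sum>i\<in>Basis. (Q s \<bullet> i) *\<^sub>R L i (p + s *\<^sub>R d)) = (W s - W t) /\<^sub>R (s - t)"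
      if s: "s \<in> ?I" "s \<noteq> t" for s
    proof -
      interpret linear "A (y s)" by (rule lin[OF y[OF s(1)]])
      have "Q s = A (y s) (- ((W s - W t) /\<^sub>R (s - t)))"
        by (simp add: Q_def AW[OF t] neg scaleR diff AW[OF s(1)] flip: scaleR_minus_right)
      then have "L (Q s) (F (y s)) = - ((W s - W t) /\<^sub>R (s - t))"
        using left[OF y[OF s(1)]] by simp
      then show ?thesis using Lsum[of "Q s" "p + s *\<^sub>R d"] seg[OF s(1)] by simp
    qed
    have "\<forall>\<^sub>F s in at t. - (\<Sum>i\<in>Basis. (Q s \<bullet> i) *\<^sub>R L i (p + s *\<^sub>R d)) = (W s - W t) /\<^sub>R (s - t)"
      unfolding eventually_at_topological using t eq by (intro exI[of _ ?I]) auto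
    from Lim_transform_eventually[OF lim this] show ?thesis
      unfolding has_vector_derivative_iff_difference_quotient by blast
  qed
  then obtain U where "\<And>t. t \<in> ?I \<Longrightarrow> (W has_vector_derivative U t) (at t)" by metis
  with c AW injA show ?thesis by blast
qed

lemma convex_segment_extends:
  fixes P :: "'a::real_normed_vector set"
  assumes "open P" "convex P" "p \<in> P" "q \<in> P"
  obtains e where "e > 0" "\<And>t. t \<in> {- e<..<1 + e} \<Longrightarrow> p + t *\<^sub>R (q - p) \<in> P"
proof -
  let ?f = "\<lambda>t::real. p + t *\<^sub>R (q - p)"
  have op: "open (?f -` P)"
    by (intro continuous_open_vimage \<open>open P\<close>) (intro continuous_intros)
  have cv: "convex (?f -` P)"
  proof (rule convexI)
    fix s t u v :: real assume *: "s \<in> ?f -` P" "t \<in> ?f -` P" "0 \<le> u" "0 \<le> v" "u + v = 1"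
    have "?f (u *\<^sub>R s + v *\<^sub>R t) = (u + v) *\<^sub>R p + (u *\<^sub>R s + v *\<^sub>R t) *\<^sub>R (q - p)"
      using * by simp
    also have "\<dots> = u *\<^sub>R ?f s + v *\<^sub>R ?f t" by (simp add: algebra_simps)
    also have "\<dots> \<in> P" using * \<open>convex P\<close> by (intro convexD) auto
    finally show "u *\<^sub>R s + v *\<^sub>R t \<in> ?f -` P" by simp
  qed
  have "0 \<in> ?f -` P" "1 \<in> ?f -` P" using assms by auto
  with op obtain d d' where d: "d > 0" "ball 0 d \<subseteq> ?f -` P" and d': "d' > 0" "ball 1 d' \<subseteq> ?f -` P"
    by (meson openE)
  define e where "e = min d d' / 2"
  have e: "e > 0" "e < d" "e < d'" using d d' by (auto simp: e_def)
  have "- e \<in> ?f -` P" by (rule subsetD[OF d(2)]) (use e in \<open>simp add: dist_real_def\<close>)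
  moreover have "1 + e \<in> ?f -` P" by (rule subsetD[OF d'(2)]) (use e in \<open>simp add: dist_real_def\<close>)
  moreover have "is_interval (?f -` P)" using cv by (simp add: is_interval_convex_1)
  ultimately have "t \<in> ?f -` P" if "t \<in> {- e<..<1 + e}" for t
    using that by (intro mem_is_interval_1_I[of "?f -` P" "- e" "1 + e" t]) auto
  then show thesis using e(1) by (intro that[of e]) auto
qed

section \<open>Partial gradients of the preference function\<close>

lemma gradient_eqI:
  assumes "GDERIV f x :> d"
  shows "gradient f x = d"
  unfolding gradient_def
proof (rule the_equality, rule assms)
  fix d' assume "GDERIV f x :> d'"
  with assms have "(\<lambda>h. h \<bullet> d') = (\<lambda>h. h \<bullet> d)"
    unfolding gderiv_def by (rule has_derivative_unique[rotated])
  then show "d' = d" by (metis inner_commute vector_eq_rdot)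
qed

text \<open>Identifies the limits by which the partial gradients are extended to the boundary.\<close>

lemma Lim_closure_open_eq:
  fixes h :: "'a::euclidean_space \<Rightarrow> 'b::t2_space"
  assumes "open S" "z \<in> closure S" "continuous_on (closure S) h" "\<And>w. w \<in> S \<Longrightarrow> f w = h w"
  shows "Lim (at z within S) f = h z"
proof (rule tendsto_Lim)
  have "z islimpt S"
  proof (cases "z \<in> S")
    case True
    then show ?thesis using assms(1) by (metis interior_limit_point interior_open)
  next
    case False
    then show ?thesis using assms(2) by (simp add: closure_def)
  qed
  then show "\<not> trivial_limit (at z within S)" by (simp add: trivial_limit_within)
  have "(h \<longlongrightarrow> h z) (at z within closure S)"
    using assms(2,3) by (simp add: continuous_on_def)
  then have "(h \<longlongrightarrow> h z) (at z within S)"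
    by (rule tendsto_within_subset) (rule closure_subset)
  moreover have "\<forall>\<^sub>F w in at z within S. h w = f w"
    using assms(4) by (auto simp: eventually_at_filter)
  ultimately show "(f \<longlongrightarrow> h z) (at z within S)" by (rule Lim_transform_eventually)
qed

text \<open>A preference function as in the theorem, together with a choice \<open>D\<close> of its jet.\<close>

locale bitwist_domain =
  fixes X Y :: "(real^'n) set" and b :: "real^'n \<Rightarrow> real^'n \<Rightarrow> real"
    and D :: "((real^'n) \<times> (real^'n)) list \<Rightarrow> (real^'n) \<times> (real^'n) \<Rightarrow> real"
  assumes openX: "open X" and bdX: "bounded X" and openY: "open Y" and bdY: "bounded Y"
    and D: "jet_on 4 (X \<times> Y) D"
    and b_eq: "\<And>x y. x \<in> closure X \<Longrightarrow> y \<in> closure Y \<Longrightarrow> b x y = D [] (x, y)"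
    and B1: "B1 X Y b" and B2: "B2 X Y b"
begin

abbreviation "grad_x \<equiv> Dx X Y b"
abbreviation "grad_y \<equiv> Dy X Y b"

lemma bdXY: "bounded (X \<times> Y)" using bdX bdY by (rule bounded_Times)

lemma D_cont:
  assumes "length vs \<le> 4" "continuous_on A f" "f ` A \<subseteq> closure X \<times> closure Y"
  shows "continuous_on A (\<lambda>t. D vs (f t))"
  by (rule continuous_on_compose2[OF jet_on_cont[OF D assms(1)] assms(2)])
     (use assms(3) in \<open>simp add: closure_Times\<close>)

lemma D_linear:
  assumes "length vs < 4" "x \<in> closure X" "y \<in> closure Y"
  shows "linear (\<lambda>v. D (v # vs) (x, y))"
  by (rule jet_on_linear[OF D]) (use assms in \<open>auto simp: closure_Times\<close>)

lemma grad_x_sum: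
  assumes x: "x \<in> closure X" and y: "y \<in> closure Y"
  shows "grad_x x y = (\<Sum>i\<in>Basis. D [(i, 0)] (x, y) *\<^sub>R i)"
proof -
  define G where "G z = (\<Sum>i\<in>Basis. D [(i, 0)] z *\<^sub>R i)" for z
  have "Lim (at (x, y) within X \<times> Y) (\<lambda>(x, y). gradient (\<lambda>x'. b x' y) x) = G (x, y)"
  proof (rule Lim_closure_open_eq)
    show "open (X \<times> Y)" using openX openY by (rule open_Times)
    show "(x, y) \<in> closure (X \<times> Y)" using x y by (simp add: closure_Times)
    show "continuous_on (closure (X \<times> Y)) G"
      unfolding G_def by (intro continuous_intros jet_on_cont[OF D]) simp
    fix z assume "z \<in> X \<times> Y"
    then obtain u v where z: "z = (u, v)" "u \<in> X" "v \<in> Y" by auto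
    have cl: "u \<in> closure X" "v \<in> closure Y" using z closure_subset by auto
    have "(D [] has_derivative (\<lambda>h. D [h] (u, v))) (at (u, v) within (\<lambda>u. (u, v)) ` UNIV)"
      by (rule has_derivative_at_withinI, rule jet_on_deriv[OF D]) (use z in auto)
    moreover have "((\<lambda>u. (u, v)) has_derivative (\<lambda>h. (h, 0))) (at u)"
      by (intro derivative_intros)
    ultimately have "((\<lambda>u. D [] (u, v)) has_derivative (\<lambda>h. D [(h, 0)] (u, v))) (at u)"
      using diff_chain_within[of "\<lambda>u. (u, v)" _ u UNIV "D []"] by (simp add: o_def)
    then have "((\<lambda>u. b u v) has_derivative (\<lambda>h. D [(h, 0)] (u, v))) (at u)"
      by (rule has_derivative_transform_within_open[OF _ openX z(2)])
         (simp add: b_eq[OF subsetD[OF closure_subset] cl(2)])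
    moreover have "D [(h, 0)] (u, v) = h \<bullet> G (u, v)" for h
    proof -
      interpret linear "\<lambda>h. D [(h, 0)] (u, v)"
        using linear_compose[OF _ D_linear[OF _ cl, of "[]"], of "\<lambda>h. (h, 0)"]
        by (simp add: o_def linear_iff)
      have "D [(h, 0)] (u, v) = D [(\<Sum>i\<in>Basis. (h \<bullet> i) *\<^sub>R i, 0)] (u, v)"
        by (simp only: euclidean_representation)
      also have "\<dots> = h \<bullet> G (u, v)"
        by (simp only: sum scaleR) (simp add: G_def inner_sum_right mult.commute)
      finally show ?thesis .
    qed
    ultimately have "GDERIV (\<lambda>u. b u v) u :> G (u, v)" by (simp add: gderiv_def)
    then show "(case z of (x, y) \<Rightarrow> gradient (\<lambda>x'. b x' y) x) = G z"
      by (simp add: z gradient_eqI)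
  qed
  then show ?thesis by (simp add: Dx_def G_def)
qed

lemma grad_y_sum:
  assumes x: "x \<in> closure X" and y: "y \<in> closure Y"
  shows "grad_y x y = (\<Sum>i\<in>Basis. D [(0, i)] (x, y) *\<^sub>R i)"
proof -
  define G where "G z = (\<Sum>i\<in>Basis. D [(0, i)] z *\<^sub>R i)" for z
  have "Lim (at (x, y) within X \<times> Y) (\<lambda>(x, y). gradient (\<lambda>y'. b x y') y) = G (x, y)"
  proof (rule Lim_closure_open_eq)
    show "open (X \<times> Y)" using openX openY by (rule open_Times)
    show "(x, y) \<in> closure (X \<times> Y)" using x y by (simp add: closure_Times)
    show "continuous_on (closure (X \<times> Y)) G"
      unfolding G_def by (intro continuous_intros jet_on_cont[OF D]) simp
    fix z assume "z \<in> X \<times> Y"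
    then obtain u v where z: "z = (u, v)" "u \<in> X" "v \<in> Y" by auto
    have cl: "u \<in> closure X" "v \<in> closure Y" using z closure_subset by auto
    have "(D [] has_derivative (\<lambda>h. D [h] (u, v))) (at (u, v) within (\<lambda>v. (u, v)) ` UNIV)"
      by (rule has_derivative_at_withinI, rule jet_on_deriv[OF D]) (use z in auto)
    moreover have "((\<lambda>v. (u, v)) has_derivative (\<lambda>h. (0, h))) (at v)"
      by (intro derivative_intros)
    ultimately have "((\<lambda>v. D [] (u, v)) has_derivative (\<lambda>h. D [(0, h)] (u, v))) (at v)"
      using diff_chain_within[of "\<lambda>v. (u, v)" _ v UNIV "D []"] by (simp add: o_def)
    then have "((\<lambda>v. b u v) has_derivative (\<lambda>h. D [(0, h)] (u, v))) (at v)"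
      by (rule has_derivative_transform_within_open[OF _ openY z(3)])
         (simp add: b_eq[OF cl(1) subsetD[OF closure_subset]])
    moreover have "D [(0, h)] (u, v) = h \<bullet> G (u, v)" for h
    proof -
      interpret linear "\<lambda>h. D [(0, h)] (u, v)"
        using linear_compose[OF _ D_linear[OF _ cl, of "[]"], of "\<lambda>h. (0, h)"]
        by (simp add: o_def linear_iff)
      have "D [(0, h)] (u, v) = D [(0, \<Sum>i\<in>Basis. (h \<bullet> i) *\<^sub>R i)] (u, v)"
        by (simp only: euclidean_representation)
      also have "\<dots> = h \<bullet> G (u, v)"
        by (simp only: sum scaleR) (simp add: G_def inner_sum_right mult.commute)
      finally show ?thesis .
    qed
    ultimately have "GDERIV (\<lambda>v. b u v) v :> G (u, v)" by (simp add: gderiv_def)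
    then show "(case z of (x, y) \<Rightarrow> gradient (\<lambda>y'. b x y') y) = G z"
      by (simp add: z gradient_eqI)
  qed
  then show ?thesis by (simp add: Dy_def G_def)
qed

lemma linear_left: "length vs < 4 \<Longrightarrow> x \<in> closure X \<Longrightarrow> y \<in> closure Y \<Longrightarrow> linear (\<lambda>v. D ((v, 0) # vs) (x, y))"
  and linear_right: "length vs < 4 \<Longrightarrow> x \<in> closure X \<Longrightarrow> y \<in> closure Y \<Longrightarrow> linear (\<lambda>v. D ((0, v) # vs) (x, y))"
  using linear_compose[OF _ D_linear, of "\<lambda>v. (v, 0)"] linear_compose[OF _ D_linear, of "\<lambda>v. (0, v)"]
  by (simp_all add: o_def linear_iff)

lemma grad_x_inner:
  assumes x: "x \<in> closure X" and y: "y \<in> closure Y"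
  shows "grad_x x y \<bullet> v = D [(v, 0)] (x, y)"
proof -
  interpret linear "\<lambda>v. D [(v, 0)] (x, y)" by (rule linear_left) (use assms in auto)
  have "D [(v, 0)] (x, y) = D [(\<Sum>i\<in>Basis. (v \<bullet> i) *\<^sub>R i, 0)] (x, y)"
    by (simp only: euclidean_representation)
  also have "\<dots> = grad_x x y \<bullet> v"
    by (simp only: sum scaleR) (simp add: grad_x_sum[OF x y] inner_sum_right inner_commute[of _ v] mult.commute)
  finally show ?thesis ..
qed

lemma grad_y_inner:
  assumes x: "x \<in> closure X" and y: "y \<in> closure Y"
  shows "grad_y x y \<bullet> v = D [(0, v)] (x, y)"
proof -
  interpret linear "\<lambda>v. D [(0, v)] (x, y)" by (rule linear_right) (use assms in auto)
  have "D [(0, v)] (x, y) = D [(0, \<Sum>i\<in>Basis. (v \<bullet> i) *\<^sub>R i)] (x, y)"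
    by (simp only: euclidean_representation)
  also have "\<dots> = grad_y x y \<bullet> v"
    by (simp only: sum scaleR) (simp add: grad_y_sum[OF x y] inner_sum_right inner_commute[of _ v] mult.commute)
  finally show ?thesis ..
qed

lemma grad_x_diffeo: "x \<in> closure X \<Longrightarrow> y \<in> closure Y \<Longrightarrow> diffeo_onto_range Y (grad_x x)"
  and grad_y_diffeo: "x \<in> closure X \<Longrightarrow> y \<in> closure Y \<Longrightarrow> diffeo_onto_range X (\<lambda>x. grad_y x y)"
  using B1 by (auto simp: B1_def)

lemma grad_x_convex: "x \<in> closure X \<Longrightarrow> y \<in> closure Y \<Longrightarrow> convex (grad_x x ` Y)"
  and grad_y_convex: "x \<in> closure X \<Longrightarrow> y \<in> closure Y \<Longrightarrow> convex ((\<lambda>x. grad_y x y) ` X)"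
  using B2 by (auto simp: B2_def)

lemma x_chain:
  assumes "length vs < 4" "inner_C1_curve X I x x'" "y \<in> closure Y" "t \<in> I"
  shows "((\<lambda>t. D vs (x t, y)) has_vector_derivative D ((x' t, 0) # vs) (x t, y)) (at t)"
  using jet_on_chain_rule[OF D assms(1) bdXY inner_C1_curve_Pair_left[OF assms(2,3)] assms(4)] .

lemma y_chain:
  assumes "length vs < 4" "inner_C1_curve Y I y y'" "x \<in> closure X" "t \<in> I"
  shows "((\<lambda>t. D vs (x, y t)) has_vector_derivative D ((0, y' t) # vs) (x, y t)) (at t)"
  using jet_on_chain_rule[OF D assms(1) bdXY inner_C1_curve_Pair_right[OF assms(2,3)] assms(4)] .

lemma x_chain2:
  assumes "length vs < 3" "inner_C1_curve X I x x'" "y \<in> closure Y" "t \<in> I"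
    and W: "(x' has_vector_derivative U) (at t)"
  shows "((\<lambda>t. D ((x' t, 0) # vs) (x t, y)) has_vector_derivative
           D ((U, 0) # vs) (x t, y) + hess D vs (x' t, 0) (x t, y)) (at t)"
  by (rule jet_on_second_derivative[OF D _ bdXY inner_C1_curve_Pair_left[OF assms(2,3)] assms(4)])
     (use assms in \<open>auto intro!: has_vector_derivative_Pair derivative_intros\<close>)

lemma y_chain2:
  assumes "length vs < 3" "inner_C1_curve Y I y y'" "x \<in> closure X" "t \<in> I"
    and W: "(y' has_vector_derivative U) (at t)"
  shows "((\<lambda>t. D ((0, y' t) # vs) (x, y t)) has_vector_derivative
           D ((0, U) # vs) (x, y t) + hess D vs (0, y' t) (x, y t)) (at t)"
  by (rule jet_on_second_derivative[OF D _ bdXY inner_C1_curve_Pair_right[OF assms(2,3)] assms(4)])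
     (use assms in \<open>auto intro!: has_vector_derivative_Pair derivative_intros\<close>)

text \<open>The curves of \<open>B3\<close> in the second variable, possibly inside the boundary. The third conclusion
  differentiates the equation of the segment, \<open>D [(0, w), (v, 0)]\<close> being the mixed second derivative
  of \<open>b\<close>; the last one is its nondegeneracy.\<close>

lemma y_segment_curve:
  assumes x0: "x0 \<in> closure X" and "l < r"
    and y: "\<And>t. t \<in> {l<..<r} \<Longrightarrow> y t \<in> closure Y"
    and seg: "\<And>t. t \<in> {l<..<r} \<Longrightarrow> grad_x x0 (y t) = p + t *\<^sub>R d"
  obtains y' y'' where "inner_C1_curve Y {l<..<r} y y'"
    and "\<And>t. t \<in> {l<..<r} \<Longrightarrow> (y' has_vector_derivative y'' t) (at t)"
    and "\<And>t v. t \<in> {l<..<r} \<Longrightarrow> D [(0, y' t), (v, 0)] (x0, y t) = d \<bullet> v"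
    and "\<And>z v w. z \<in> closure Y \<Longrightarrow>
           (\<And>i. i \<in> Basis \<Longrightarrow> D [(0, v), (i, 0)] (x0, z) = D [(0, w), (i, 0)] (x0, z)) \<Longrightarrow> v = w"
proof -
  define A where "A z v = (\<Sum>i\<in>Basis. D [(0, v), (i, 0)] (x0, z) *\<^sub>R i)" for z v
  have y0: "y ((l + r) / 2) \<in> closure Y" using \<open>l < r\<close> by (intro y) auto
  have lin: "linear (A z)" if "z \<in> closure Y" for z
    by (rule linearI)
       (simp_all add: A_def linear_add[OF linear_right] linear_scale[OF linear_right] x0 that
          scaleR_add_left sum.distrib scaleR_sum_right)
  have cont: "continuous_on (closure Y) (\<lambda>z. A z v)" for v
    unfolding A_def by (intro continuous_intros D_cont) (use x0 in auto)
  have chain: "((\<lambda>t. grad_x x0 (Z t)) has_vector_derivative A (Z t) (W t)) (at t)"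
    if Z: "inner_C1_curve Y I Z W" and t: "t \<in> I" for I Z W t
  proof -
    have "((\<lambda>t. \<Sum>i\<in>Basis. D [(i, 0)] (x0, Z t) *\<^sub>R i) has_vector_derivative A (Z t) (W t)) (at t)"
      unfolding A_def
      by (intro has_vector_derivative_sum
          bounded_linear.has_vector_derivative[OF bounded_linear_scaleR_left] y_chain[OF _ Z x0 t]) simp
    then show ?thesis
      by (rule has_vector_derivative_transform_within_open[OF _ _ t])
         (use Z grad_x_sum[OF x0 inner_C1_curve_closure[OF Z]] in \<open>auto simp: inner_C1_curve_def\<close>)
  qed
  have chainA: "\<exists>u. ((\<lambda>t. A (Z t) v) has_vector_derivative u) (at t)"
    if Z: "inner_C1_curve Y I Z W" and t: "t \<in> I" for I Z W t v
    unfolding A_def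
    by (rule exI[of _ "\<Sum>i\<in>Basis. D [(0, W t), (0, v), (i, 0)] (x0, Z t) *\<^sub>R i"],
        intro has_vector_derivative_sum
          bounded_linear.has_vector_derivative[OF bounded_linear_scaleR_left] y_chain[OF _ Z x0 t]) simp
  have "\<exists>W U. inner_C1_curve Y {l<..<r} y W \<and>
      (\<forall>t\<in>{l<..<r}. (W has_vector_derivative U t) (at t) \<and> A (y t) (W t) = d) \<and>
      (\<forall>z\<in>closure Y. inj (A z))"
    by (rule segment_curve_twice_differentiable[where F="grad_x x0",
          OF openY bdY grad_x_diffeo[OF x0 y0] grad_x_convex[OF x0 y0]])
       (assumption | rule lin cont chain chainA y seg)+
  then obtain y' y'' where c: "inner_C1_curve Y {l<..<r} y y'"
    and y'': "\<And>t. t \<in> {l<..<r} \<Longrightarrow> (y' has_vector_derivative y'' t) (at t)"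
    and inj: "\<And>z. z \<in> closure Y \<Longrightarrow> inj (A z)"
    by blast
  show thesis
  proof (rule that[OF c y''])
    fix t v assume t: "t \<in> {l<..<r}"
    have "((\<lambda>t. grad_x x0 (y t) \<bullet> v) has_vector_derivative D [(0, y' t), (v, 0)] (x0, y t)) (at t)"
      by (rule has_vector_derivative_transform_within_open[OF y_chain[OF _ c x0 t, of "[(v, 0)]"] _ t])
         (use grad_x_inner[OF x0 y] in auto)
    then have "((\<lambda>t. (p + t *\<^sub>R d) \<bullet> v) has_vector_derivative D [(0, y' t), (v, 0)] (x0, y t)) (at t)"
      by (rule has_vector_derivative_transform_within_open[OF _ _ t]) (use seg in auto)
    moreover have "((\<lambda>t. (p + t *\<^sub>R d) \<bullet> v) has_vector_derivative d \<bullet> v) (at t)"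
      by (auto intro!: derivative_eq_intros simp: inner_add_left)
    ultimately show "D [(0, y' t), (v, 0)] (x0, y t) = d \<bullet> v"
      by (rule vector_derivative_unique_at)
  next
    fix z v w assume "z \<in> closure Y"
      and "\<And>i. i \<in> Basis \<Longrightarrow> D [(0, v), (i, 0)] (x0, z) = D [(0, w), (i, 0)] (x0, z)"
    then have "A z v = A z w" unfolding A_def by (intro sum.cong) auto
    then show "v = w" using injD[OF inj[OF \<open>z \<in> closure Y\<close>]] by blast
  qed
qed

lemma x_segment_curve:
  assumes y0: "y0 \<in> closure Y" and "l < r"
    and x: "\<And>t. t \<in> {l<..<r} \<Longrightarrow> x t \<in> closure X"
    and seg: "\<And>t. t \<in> {l<..<r} \<Longrightarrow> grad_y (x t) y0 = p + t *\<^sub>R d"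
  obtains x' x'' where "inner_C1_curve X {l<..<r} x x'"
    and "\<And>t. t \<in> {l<..<r} \<Longrightarrow> (x' has_vector_derivative x'' t) (at t)"
    and "\<And>t v. t \<in> {l<..<r} \<Longrightarrow> D [(x' t, 0), (0, v)] (x t, y0) = d \<bullet> v"
proof -
  define A where "A z v = (\<Sum>i\<in>Basis. D [(v, 0), (0, i)] (z, y0) *\<^sub>R i)" for z v
  have x0: "x ((l + r) / 2) \<in> closure X" using \<open>l < r\<close> by (intro x) auto
  have lin: "linear (A z)" if "z \<in> closure X" for z
    by (rule linearI)
       (simp_all add: A_def linear_add[OF linear_left] linear_scale[OF linear_left] y0 that
          scaleR_add_left sum.distrib scaleR_sum_right)
  have cont: "continuous_on (closure X) (\<lambda>z. A z v)" for v
    unfolding A_def by (intro continuous_intros D_cont) (use y0 in auto)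
  have chain: "((\<lambda>t. grad_y (Z t) y0) has_vector_derivative A (Z t) (W t)) (at t)"
    if Z: "inner_C1_curve X I Z W" and t: "t \<in> I" for I Z W t
  proof -
    have "((\<lambda>t. \<Sum>i\<in>Basis. D [(0, i)] (Z t, y0) *\<^sub>R i) has_vector_derivative A (Z t) (W t)) (at t)"
      unfolding A_def
      by (intro has_vector_derivative_sum
          bounded_linear.has_vector_derivative[OF bounded_linear_scaleR_left] x_chain[OF _ Z y0 t]) simp
    then show ?thesis
      by (rule has_vector_derivative_transform_within_open[OF _ _ t])
         (use Z grad_y_sum[OF inner_C1_curve_closure[OF Z] y0] in \<open>auto simp: inner_C1_curve_def\<close>)
  qed
  have chainA: "\<exists>u. ((\<lambda>t. A (Z t) v) has_vector_derivative u) (at t)"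
    if Z: "inner_C1_curve X I Z W" and t: "t \<in> I" for I Z W t v
    unfolding A_def
    by (rule exI[of _ "\<Sum>i\<in>Basis. D [(W t, 0), (v, 0), (0, i)] (Z t, y0) *\<^sub>R i"],
        intro has_vector_derivative_sum
          bounded_linear.has_vector_derivative[OF bounded_linear_scaleR_left] x_chain[OF _ Z y0 t]) simp
  have "\<exists>W U. inner_C1_curve X {l<..<r} x W \<and>
      (\<forall>t\<in>{l<..<r}. (W has_vector_derivative U t) (at t) \<and> A (x t) (W t) = d) \<and>
      (\<forall>z\<in>closure X. inj (A z))"
    by (rule segment_curve_twice_differentiable[where F="\<lambda>x. grad_y x y0",
          OF openX bdX grad_y_diffeo[OF x0 y0] grad_y_convex[OF x0 y0]])
       (assumption | rule lin cont chain chainA x seg)+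
  then obtain x' x'' where c: "inner_C1_curve X {l<..<r} x x'"
    and x'': "\<And>t. t \<in> {l<..<r} \<Longrightarrow> (x' has_vector_derivative x'' t) (at t)"
    by blast
  show thesis
  proof (rule that[OF c x''])
    fix t v assume t: "t \<in> {l<..<r}"
    have "((\<lambda>t. grad_y (x t) y0 \<bullet> v) has_vector_derivative D [(x' t, 0), (0, v)] (x t, y0)) (at t)"
      by (rule has_vector_derivative_transform_within_open[OF x_chain[OF _ c y0 t, of "[(0, v)]"] _ t])
         (use grad_y_inner[OF x y0] in auto)
    then have "((\<lambda>t. (p + t *\<^sub>R d) \<bullet> v) has_vector_derivative D [(x' t, 0), (0, v)] (x t, y0)) (at t)"
      by (rule has_vector_derivative_transform_within_open[OF _ _ t]) (use seg in auto)
    moreover have "((\<lambda>t. (p + t *\<^sub>R d) \<bullet> v) has_vector_derivative d \<bullet> v) (at t)"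
      by (auto intro!: derivative_eq_intros simp: inner_add_left)
    ultimately show "D [(x' t, 0), (0, v)] (x t, y0) = d \<bullet> v"
      by (rule vector_derivative_unique_at)
  qed
qed

lemma grad_x_tendsto:
  assumes "f \<longlonglongrightarrow> x" "g \<longlonglongrightarrow> y" "\<And>n. f n \<in> closure X" "\<And>n. g n \<in> closure Y"
    "x \<in> closure X" "y \<in> closure Y"
  shows "(\<lambda>n. grad_x (f n) (g n)) \<longlonglongrightarrow> grad_x x y"
proof -
  have "(\<lambda>n. D [(i, 0)] (f n, g n)) \<longlonglongrightarrow> D [(i, 0)] (x, y)" for i
    by (rule continuous_on_tendsto_compose[OF jet_on_cont[OF D]])
       (use assms in \<open>auto simp: closure_Times intro: tendsto_Pair\<close>)
  then have "(\<lambda>n. \<Sum>i\<in>Basis. D [(i, 0)] (f n, g n) *\<^sub>R i) \<longlonglongrightarrow> (\<Sum>i\<in>Basis. D [(i, 0)] (x, y) *\<^sub>R i)"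
    by (intro tendsto_intros)
  then show ?thesis using assms by (simp add: grad_x_sum)
qed

lemma b_tendsto:
  assumes "f \<longlonglongrightarrow> x" "g \<longlonglongrightarrow> y" "\<And>n. f n \<in> closure X" "\<And>n. g n \<in> closure Y"
    "x \<in> closure X" "y \<in> closure Y"
  shows "(\<lambda>n. b (f n) (g n)) \<longlonglongrightarrow> b x y"
proof -
  have "(\<lambda>n. D [] (f n, g n)) \<longlonglongrightarrow> D [] (x, y)"
    by (rule continuous_on_tendsto_compose[OF jet_on_cont[OF D]])
       (use assms in \<open>auto simp: closure_Times intro: tendsto_Pair\<close>)
  then show ?thesis using assms by (simp add: b_eq)
qed

lemma grad_x_inj:
  assumes "x \<in> closure X" "y \<in> closure Y" "z \<in> closure Y" "grad_x x y = grad_x x z"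
  shows "y = z"
  using grad_x_diffeo[OF assms(1,2)] assms(2-)
  unfolding diffeo_onto_range_def homeomorphism_def by metis

lemma grad_range:
  assumes "x \<in> closure X" "y \<in> closure Y"
  shows "open (grad_x x ` Y)" "closure (grad_x x ` Y) = grad_x x ` closure Y"
    "open ((\<lambda>x. grad_y x y) ` X)"
proof -
  show "open (grad_x x ` Y)"
    by (rule diffeo_onto_range_inverse[OF openY bdY grad_x_diffeo[OF assms]])
  show "closure (grad_x x ` Y) = grad_x x ` closure Y"
    by (rule diffeo_onto_range_inverse[OF openY bdY grad_x_diffeo[OF assms]])
  show "open ((\<lambda>x. grad_y x y) ` X)"
    by (rule diffeo_onto_range_inverse[OF openX bdX grad_y_diffeo[OF assms]])
qed

lemma grad_y_inj:
  assumes "y \<in> closure Y" "x \<in> closure X" "z \<in> closure X" "grad_y x y = grad_y z y"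
  shows "x = z"
  using grad_y_diffeo[OF assms(2,1)] assms(2-)
  unfolding diffeo_onto_range_def homeomorphism_def by metis

section \<open>Fourth derivatives along pairs of segment curves\<close>

text \<open>The acceleration enters the second derivative only through \<open>grad_y x (y t)\<close>, which is affine along
  a segment curve in \<open>x\<close>.\<close>

lemma b_y_curve:
  assumes c: "inner_C1_curve Y I y y'" and x: "x \<in> closure X" and t: "t \<in> I"
  shows "((\<lambda>t. b x (y t)) has_real_derivative D [(0, y' t)] (x, y t)) (at t)"
    and "(y' has_vector_derivative U) (at t) \<Longrightarrow>
      ((\<lambda>t. D [(0, y' t)] (x, y t)) has_real_derivative
        grad_y x (y t) \<bullet> U + hess D [] (0, y' t) (x, y t)) (at t)"
proof -
  have I: "open I" using c by (simp add: inner_C1_curve_def)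
  have "((\<lambda>t. D [] (x, y t)) has_vector_derivative D [(0, y' t)] (x, y t)) (at t)"
    by (rule y_chain[OF _ c x t]) simp
  then show "((\<lambda>t. b x (y t)) has_real_derivative D [(0, y' t)] (x, y t)) (at t)"
    unfolding has_real_derivative_iff_has_vector_derivative
    by (rule has_vector_derivative_transform_within_open[OF _ I t])
       (simp add: b_eq[OF x inner_C1_curve_closure[OF c]])
  assume "(y' has_vector_derivative U) (at t)"
  from y_chain2[OF _ c x t this, of "[]"]
  show "((\<lambda>t. D [(0, y' t)] (x, y t)) has_real_derivative
        grad_y x (y t) \<bullet> U + hess D [] (0, y' t) (x, y t)) (at t)"
    by (simp add: has_real_derivative_iff_has_vector_derivative
        grad_y_inner[OF x inner_C1_curve_closure[OF c t]])
qed

lemma b_y_curve_deriv2: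
  assumes c: "inner_C1_curve Y I y y'" and x: "x \<in> closure X" and t: "t \<in> I"
    and "(y' has_vector_derivative U) (at t)"
  shows "(deriv ^^ 2) (\<lambda>t. b x (y t)) t = grad_y x (y t) \<bullet> U + hess D [] (0, y' t) (x, y t)"
  using c deriv2I[OF _ t b_y_curve(1)[OF c x] b_y_curve(2)[OF c x t assms(4)]]
  by (simp add: inner_C1_curve_def)

lemma hess_x_curve:
  fixes w :: "(real^'n) \<times> (real^'n)"
  assumes c: "inner_C1_curve X I x x'" and y: "y \<in> closure Y"
    and x'': "\<And>t. t \<in> I \<Longrightarrow> (x' has_vector_derivative x'' t) (at t)"
  defines "h' \<equiv> \<lambda>t. \<Sum>i\<in>Basis. \<Sum>j\<in>Basis. (w \<bullet> i) * (w \<bullet> j) * D [(x' t, 0), j, i] (x t, y)"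
  shows "\<exists>h''. \<forall>t\<in>I. ((\<lambda>t. hess D [] w (x t, y)) has_real_derivative h' t) (at t) \<and>
      (h' has_real_derivative h'' t) (at t)"
proof -
  define h'' where "h'' t = (\<Sum>i\<in>Basis. \<Sum>j\<in>Basis. (w \<bullet> i) * (w \<bullet> j) *
      (D [(x'' t, 0), j, i] (x t, y) + hess D [j, i] (x' t, 0) (x t, y)))" for t
  have "((\<lambda>t. hess D [] w (x t, y)) has_real_derivative h' t) (at t)" if t: "t \<in> I" for t
    unfolding hess_def h'_def
    by (intro DERIV_sum DERIV_cmult)
       (use x_chain[OF _ c y t] in \<open>simp add: has_real_derivative_iff_has_vector_derivative\<close>)
  moreover have "(h' has_real_derivative h'' t) (at t)" if t: "t \<in> I" for t
    unfolding h''_def h'_def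
    by (intro DERIV_sum DERIV_cmult)
       (use x_chain2[OF _ c y t x''[OF t]] in \<open>simp add: has_real_derivative_iff_has_vector_derivative\<close>)
  ultimately show ?thesis by blast
qed

lemma third_derivative_symmetric:
  assumes "x \<in> X" "y \<in> Y"
  shows "D [u, v, w] (x, y) = D [v, w, u] (x, y)"
proof -
  have z: "(x, y) \<in> X \<times> Y" and op: "open (X \<times> Y)" using assms openX openY by (auto intro: open_Times)
  have "D [u, v, w] (x, y) = D [v, u, w] (x, y)"
    by (rule jet_on_Clairaut[OF D _ op z]) simp
  also have "\<dots> = D [v, w, u] (x, y)"
    by (rule jet_on_cong_Cons[OF D op z]) (auto intro: jet_on_Clairaut[OF D _ op])
  finally show ?thesis .
qed

section \<open>Convexity along segments\<close>

text \<open>\<open>z\<close> is the point with parameter \<open>t\<close> of the \<open>b\<close>-segment from \<open>y0\<close> to \<open>y1\<close> seen from \<open>x0\<close>. The sets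
  \<open>A\<close> and \<open>B\<close> are \<open>X\<close> and \<open>Y\<close> or their closures.\<close>

definition segment_convexity :: "(real^'n) set \<Rightarrow> (real^'n) set \<Rightarrow> bool" where
  "segment_convexity A B \<longleftrightarrow>
     (\<forall>x\<in>A. \<forall>x0\<in>A. \<forall>y0\<in>B. \<forall>y1\<in>B. \<forall>z\<in>closure Y. \<forall>t\<in>{0..1}.
        grad_x x0 z = (1 - t) *\<^sub>R grad_x x0 y0 + t *\<^sub>R grad_x x0 y1 \<longrightarrow>
        b x z - b x0 z \<le> (1 - t) * (b x y0 - b x0 y0) + t * (b x y1 - b x0 y1))"

lemma segment_convexityD:
  assumes "segment_convexity A B" "x \<in> A" "x0 \<in> A" "y0 \<in> B" "y1 \<in> B" "z \<in> closure Y"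
    "0 \<le> t" "t \<le> 1" "grad_x x0 z = (1 - t) *\<^sub>R grad_x x0 y0 + t *\<^sub>R grad_x x0 y1"
  shows "b x z - b x0 z \<le> (1 - t) * (b x y0 - b x0 y0) + t * (b x y1 - b x0 y1)"
  using assms unfolding segment_convexity_def by simp

text \<open>Approximate \<open>x\<close>, \<open>x0\<close>, \<open>y0\<close>, \<open>y1\<close> from inside. The corresponding points of the approximating
  \<open>b\<close>-segments have a limit point, and by injectivity of \<open>D\<^sub>xb(x0, \<cdot>)\<close> it can only be \<open>z\<close>.\<close>

lemma segment_convexity_closure:
  assumes "segment_convexity X Y"
  shows "segment_convexity (closure X) (closure Y)"
  unfolding segment_convexity_def
proof (intro ballI impI)
  fix x x0 y0 y1 z t
  assume x: "x \<in> closure X" "x0 \<in> closure X" and y: "y0 \<in> closure Y" "y1 \<in> closure Y" "z \<in> closure Y"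
    and t: "t \<in> {0..1::real}" and z: "grad_x x0 z = (1 - t) *\<^sub>R grad_x x0 y0 + t *\<^sub>R grad_x x0 y1"
  from x obtain xn x0n where xn: "\<forall>n. xn n \<in> X" "xn \<longlonglongrightarrow> x" "\<forall>n. x0n n \<in> X" "x0n \<longlonglongrightarrow> x0"
    by (auto simp: closure_sequential)
  from y obtain y0n y1n where yn: "\<forall>n. y0n n \<in> Y" "y0n \<longlonglongrightarrow> y0" "\<forall>n. y1n n \<in> Y" "y1n \<longlonglongrightarrow> y1"
    by (auto simp: closure_sequential)
  have cl: "xn n \<in> closure X" "x0n n \<in> closure X" "y0n n \<in> closure Y" "y1n n \<in> closure Y" for n
    using xn yn closure_subset by blast+
  have "\<exists>w\<in>Y. grad_x (x0n n) w = (1 - t) *\<^sub>R grad_x (x0n n) (y0n n) + t *\<^sub>R grad_x (x0n n) (y1n n)" for n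
  proof -
    have "(1 - t) *\<^sub>R grad_x (x0n n) (y0n n) + t *\<^sub>R grad_x (x0n n) (y1n n) \<in> grad_x (x0n n) ` Y"
      by (rule convexD[OF grad_x_convex[OF cl(2,3)]]) (use yn t in auto)
    then show ?thesis by auto
  qed
  then obtain zn where zn: "\<And>n. zn n \<in> Y"
    "\<And>n. grad_x (x0n n) (zn n) = (1 - t) *\<^sub>R grad_x (x0n n) (y0n n) + t *\<^sub>R grad_x (x0n n) (y1n n)"
    by metis
  then have zcl: "zn n \<in> closure Y" for n using closure_subset by blast
  have "compact (closure Y)" using bdY by simp
  then obtain z' r where z': "z' \<in> closure Y" and r: "strict_mono r" and lim: "(zn \<circ> r) \<longlonglongrightarrow> z'"
    unfolding compact_def using zcl by meson
  note sub = LIMSEQ_subseq_LIMSEQ[OF _ r]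
  have "(\<lambda>n. grad_x ((x0n \<circ> r) n) ((zn \<circ> r) n)) \<longlonglongrightarrow> grad_x x0 z'"
    by (rule grad_x_tendsto[OF sub lim]) (use xn cl zcl x z' in auto)
  moreover have "(\<lambda>n. (1 - t) *\<^sub>R grad_x ((x0n \<circ> r) n) ((y0n \<circ> r) n) + t *\<^sub>R grad_x ((x0n \<circ> r) n) ((y1n \<circ> r) n))
      \<longlonglongrightarrow> (1 - t) *\<^sub>R grad_x x0 y0 + t *\<^sub>R grad_x x0 y1"
    by (intro tendsto_intros grad_x_tendsto sub) (use xn yn cl x y in auto)
  ultimately have "grad_x x0 z' = grad_x x0 z"
    using zn(2) z by (simp add: LIMSEQ_unique)
  then have "z' = z" using grad_x_inj x z' y by blast
  have L: "(\<lambda>n. b ((xn \<circ> r) n) ((zn \<circ> r) n) - b ((x0n \<circ> r) n) ((zn \<circ> r) n)) \<longlonglongrightarrow> b x z - b x0 z"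
    by (intro tendsto_diff b_tendsto[OF sub lim[unfolded \<open>z' = z\<close>]])
       (use xn cl zcl x y in auto)
  have R: "(\<lambda>n. (1 - t) * (b ((xn \<circ> r) n) ((y0n \<circ> r) n) - b ((x0n \<circ> r) n) ((y0n \<circ> r) n)) +
      t * (b ((xn \<circ> r) n) ((y1n \<circ> r) n) - b ((x0n \<circ> r) n) ((y1n \<circ> r) n)))
      \<longlonglongrightarrow> (1 - t) * (b x y0 - b x0 y0) + t * (b x y1 - b x0 y1)"
    by (intro tendsto_intros b_tendsto sub) (use xn yn cl x y in auto)
  show "b x z - b x0 z \<le> (1 - t) * (b x y0 - b x0 y0) + t * (b x y1 - b x0 y1)"
    by (rule LIMSEQ_le[OF L R], intro exI[of _ 0] allI impI, rule segment_convexityD[OF assms])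
       (use xn yn zcl zn t in auto)
qed

section \<open>Convexity along segments and cross-curvature\<close>

text \<open>\<open>G s\<close> is the inner second derivative in \<open>B3\<close>. The difference \<open>G s - G 0\<close> is the second derivative
  at \<open>0\<close> of \<open>b (x s) (y t) - b (x 0) (y t)\<close> in \<open>t\<close>, for which segment convexity is the midpoint
  inequality. So \<open>G\<close> is minimal at \<open>0\<close>.\<close>

lemma segment_convexity_imp_B3:
  assumes C: "segment_convexity (closure X) (closure Y)"
  shows "B3 X Y b"
  unfolding B3_def
proof (intro allI impI)
  fix x y :: "real \<Rightarrow> real^'n"
  assume cl: "\<forall>t\<in>{-1..1}. x t \<in> closure X \<and> y t \<in> closure Y"
    and "\<exists>p d. \<forall>t\<in>{-1..1}. (grad_y (x t) (y 0), grad_x (x 0) (y t)) = p + t *\<^sub>R d"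
  then obtain p d where "\<And>t. t \<in> {-1..1} \<Longrightarrow> (grad_y (x t) (y 0), grad_x (x 0) (y t)) = p + t *\<^sub>R d"
    by blast
  then have segx: "\<And>t. t \<in> {-1..1} \<Longrightarrow> grad_y (x t) (y 0) = fst p + t *\<^sub>R fst d"
    and segy: "\<And>t. t \<in> {-1..1} \<Longrightarrow> grad_x (x 0) (y t) = snd p + t *\<^sub>R snd d"
    by (auto simp: prod_eq_iff)
  let ?I = "{-1<..<1::real}"
  have x: "x t \<in> closure X" and y: "y t \<in> closure Y" if "t \<in> {-1..1}" for t using cl that by auto
  have x0: "x 0 \<in> closure X" and y0: "y 0 \<in> closure Y" using x[of 0] y[of 0] by auto
  obtain y' y'' where cy: "inner_C1_curve Y ?I y y'"
    and y'': "\<And>t. t \<in> ?I \<Longrightarrow> (y' has_vector_derivative y'' t) (at t)"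
    by (rule y_segment_curve[OF x0, of "-1" 1 y "snd p" "snd d"]) (use y segy in auto)
  obtain x' x'' where cx: "inner_C1_curve X ?I x x'"
    and x'': "\<And>t. t \<in> ?I \<Longrightarrow> (x' has_vector_derivative x'' t) (at t)"
    by (rule x_segment_curve[OF y0, of "-1" 1 x "fst p" "fst d"]) (use x segx in auto)
  define G where "G s = (fst p + s *\<^sub>R fst d) \<bullet> y'' 0 + hess D [] (0, y' 0) (x s, y 0)" for s
  have G: "(deriv ^^ 2) (\<lambda>t. b (x s) (y t)) 0 = G s" if "s \<in> ?I" for s
    using b_y_curve_deriv2[OF cy x _ y'', of s 0] segx[of s] that by (simp add: G_def)
  define h' where "h' = (\<lambda>t. \<Sum>i\<in>Basis. \<Sum>j\<in>Basis.
      ((0, y' 0) \<bullet> i) * ((0, y' 0) \<bullet> j) * D [(x' t, 0), j, i] (x t, y 0))"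
  have "\<exists>h''. \<forall>t\<in>?I. ((\<lambda>t. hess D [] (0, y' 0) (x t, y 0)) has_real_derivative h' t) (at t) \<and>
      (h' has_real_derivative h'' t) (at t)"
    unfolding h'_def by (rule hess_x_curve[OF cx y0 x''])
  then obtain h'' where h': "\<And>t. t \<in> ?I \<Longrightarrow> ((\<lambda>t. hess D [] (0, y' 0) (x t, y 0)) has_real_derivative h' t) (at t)"
    and h'': "\<And>t. t \<in> ?I \<Longrightarrow> (h' has_real_derivative h'' t) (at t)"
    by blast
  have G': "(G has_real_derivative fst d \<bullet> y'' 0 + h' s) (at s)" if "s \<in> ?I" for s
  proof -
    have "((\<lambda>s. (fst p + s *\<^sub>R fst d) \<bullet> y'' 0) has_real_derivative fst d \<bullet> y'' 0) (at s)"
      by (auto intro!: derivative_eq_intros simp: inner_add_left has_real_derivative_iff_has_vector_derivative)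
    from DERIV_add[OF this h'[OF that]] show ?thesis by (simp add: G_def[abs_def])
  qed
  have G'': "((\<lambda>s. fst d \<bullet> y'' 0 + h' s) has_real_derivative h'' 0) (at 0)"
    using DERIV_add[OF DERIV_const h''[of 0]] by simp
  have "((\<lambda>s. (deriv ^^ 2) (\<lambda>t. b (x s) (y t)) 0) has_real_derivative fst d \<bullet> y'' 0 + h' s) (at s)"
    if "s \<in> ?I" for s
    by (rule has_field_derivative_transform_within_open[OF G'[OF that] _ that]) (use G in auto)
  then have "(deriv ^^ 2) (\<lambda>s. (deriv ^^ 2) (\<lambda>t. b (x s) (y t)) 0) 0 = h'' 0"
    by (intro deriv2I[OF _ _ _ G'', of ?I]) auto
  moreover have "h'' 0 \<ge> 0"
  proof (rule second_derivative_nonneg[OF zero_less_one G' G''])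
    have "G 0 \<le> G s" if s: "\<bar>s\<bar> < 1" for s
    proof -
      have xs: "x s \<in> closure X" by (rule x) (use s in \<open>auto simp: abs_less_iff\<close>)
      define f where "f t = b (x s) (y t) - b (x 0) (y t)" for t
      have "0 \<le> (grad_y (x s) (y 0) \<bullet> y'' 0 + hess D [] (0, y' 0) (x s, y 0)) -
                (grad_y (x 0) (y 0) \<bullet> y'' 0 + hess D [] (0, y' 0) (x 0, y 0))"
      proof (rule second_derivative_nonneg[OF zero_less_one])
        show "(f has_real_derivative D [(0, y' t)] (x s, y t) - D [(0, y' t)] (x 0, y t)) (at t)"
          if "\<bar>t\<bar> < 1" for t
          unfolding f_def by (intro DERIV_diff b_y_curve[OF cy] xs x0) (use that in \<open>auto simp: abs_less_iff\<close>)
        show "((\<lambda>t. D [(0, y' t)] (x s, y t) - D [(0, y' t)] (x 0, y t)) has_real_derivative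
            (grad_y (x s) (y 0) \<bullet> y'' 0 + hess D [] (0, y' 0) (x s, y 0)) -
            (grad_y (x 0) (y 0) \<bullet> y'' 0 + hess D [] (0, y' 0) (x 0, y 0))) (at 0)"
          by (intro DERIV_diff b_y_curve(2)[OF cy] xs x0 y'') auto
        show "2 * f 0 \<le> f t + f (- t)" if t: "\<bar>t\<bar> < 1" for t
        proof -
          have "grad_x (x 0) (y 0) = (1 - 1/2) *\<^sub>R grad_x (x 0) (y (- t)) + (1/2) *\<^sub>R grad_x (x 0) (y t)"
          proof -
            have "grad_x (x 0) (y 0) = snd p" "grad_x (x 0) (y (- t)) = snd p - t *\<^sub>R snd d"
                 "grad_x (x 0) (y t) = snd p + t *\<^sub>R snd d"
              using segy[of 0] segy[of "- t"] segy[of t] t by (auto simp: abs_less_iff)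
            then show ?thesis by (simp add: scaleR_add_right scaleR_diff_right flip: scaleR_add_left)
          qed
          from segment_convexityD[OF C xs x0 _ _ y0 _ _ this] t y[of t] y[of "- t"]
          show ?thesis by (simp add: f_def abs_less_iff field_simps)
        qed
      qed
      then show ?thesis using segx[of s] segx[of 0] s by (simp add: G_def abs_less_iff)
    qed
    then show "2 * G 0 \<le> G t + G (- t)" if "\<bar>t\<bar> < 1" for t
      using that by (smt (verit) abs_minus_cancel)
  qed auto
  ultimately show "0 \<le> (deriv ^^ 2) (\<lambda>s. (deriv ^^ 2) (\<lambda>t. b (x s) (y t)) 0) 0" by simp
qed

text \<open>\<open>B3\<close> is applied to the given segment curve in \<open>x\<close>, recentred at \<open>\<sigma>\<close> and slowed down by a factor
  \<open>\<delta>\<close>, and to a short \<open>b\<close>-segment seen from \<open>x \<sigma>\<close> that passes through \<open>y0\<close> with velocity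
  \<open>\<delta> *\<^sub>R w\<close>. Its acceleration contributes only an affine function of the parameter of \<open>x\<close>, so the
  cross-curvature is \<open>\<delta> ^ 4 * m\<close>.\<close>

lemma B3_imp_hess_nonneg:
  assumes B3: "B3 X Y b" and y0: "y0 \<in> Y"
    and x: "\<And>t. t \<in> {l<..<r} \<Longrightarrow> x t \<in> X"
    and seg: "\<And>t. t \<in> {l<..<r} \<Longrightarrow> grad_y (x t) y0 = p + t *\<^sub>R d"
    and h': "\<And>t. t \<in> {l<..<r} \<Longrightarrow> ((\<lambda>t. hess D [] (0, w) (x t, y0)) has_real_derivative h' t) (at t)"
    and h'': "(h' has_real_derivative m) (at \<sigma>)"
    and \<sigma>: "\<sigma> \<in> {l<..<r}"
  shows "m \<ge> 0"
proof -
  have xcl: "x t \<in> closure X" if "t \<in> {l<..<r}" for t using x[OF that] closure_subset by blast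
  have y0cl: "y0 \<in> closure Y" using y0 closure_subset by blast
  let ?x = "x \<sigma>"
  have x0cl: "?x \<in> closure X" by (rule xcl[OF \<sigma>])
  \<comment> \<open>The direction in the range of \<open>grad_x\<close> whose segment leaves \<open>y0\<close> with velocity \<open>w\<close>.\<close>
  define d' where "d' = (\<Sum>i\<in>Basis. D [(0, w), (i, 0)] (?x, y0) *\<^sub>R i)"
  have d'i: "d' \<bullet> i = D [(0, w), (i, 0)] (?x, y0)" if "i \<in> Basis" for i
    using that by (simp add: d'_def inner_sum_left inner_Basis if_distrib cong: if_cong)
  obtain \<rho> where \<rho>: "\<rho> > 0" "ball (grad_x ?x y0) \<rho> \<subseteq> grad_x ?x ` Y"
    using grad_range(1)[OF x0cl y0cl] y0 openE by blast
  define \<delta> where "\<delta> = min (\<rho> / (norm d' + 1)) (min (\<sigma> - l) (r - \<sigma>)) / 2"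
  have pos: "norm d' + 1 > 0" by (smt (verit) norm_ge_zero)
  have \<delta>: "\<delta> > 0" using \<rho> \<sigma> pos by (simp add: \<delta>_def)
  have \<delta>J: "\<delta> < \<sigma> - l" "\<delta> < r - \<sigma>" using \<delta> by (auto simp: \<delta>_def min_def split: if_splits)
  have J: "\<sigma> + \<delta> * s \<in> {l<..<r}" if "s \<in> {-1..1}" for s
  proof -
    have "\<delta> * s \<le> \<delta> * 1" "\<delta> * (-1) \<le> \<delta> * s" using \<delta> that by (intro mult_left_mono; simp)+
    then show ?thesis using \<delta>J by auto
  qed
  have "\<exists>y\<in>Y. grad_x ?x y = grad_x ?x y0 + t *\<^sub>R (\<delta> *\<^sub>R d')" if t: "t \<in> {-1..1}" for t
  proof -
    have "norm (t *\<^sub>R (\<delta> *\<^sub>R d')) = \<bar>t\<bar> * (\<delta> * norm d')" using \<delta> by (simp add: abs_mult)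
    also have "\<dots> \<le> 1 * (\<delta> * norm d')" using t \<delta> by (intro mult_right_mono) auto
    also have "\<dots> < \<delta> * (norm d' + 1)" using \<delta> by simp
    also have "\<dots> < \<rho>"
    proof -
      have "\<delta> * 2 \<le> \<rho> / (norm d' + 1)" unfolding \<delta>_def by simp
      with \<delta> have "\<delta> < \<rho> / (norm d' + 1)" by linarith
      then show ?thesis using pos by (simp add: pos_less_divide_eq)
    qed
    finally have "grad_x ?x y0 + t *\<^sub>R (\<delta> *\<^sub>R d') \<in> ball (grad_x ?x y0) \<rho>" by (simp add: dist_norm)
    then show ?thesis using \<rho>(2) by (metis (no_types, lifting) imageE subset_iff)
  qed
  then obtain y where y: "\<And>t. t \<in> {-1..1} \<Longrightarrow> y t \<in> Y"
    and segy: "\<And>t. t \<in> {-1..1} \<Longrightarrow> grad_x ?x (y t) = grad_x ?x y0 + t *\<^sub>R (\<delta> *\<^sub>R d')"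
    by metis
  have ycl: "y t \<in> closure Y" if "t \<in> {-1..1}" for t using y[OF that] closure_subset by blast
  have "y 0 = y0" using grad_x_inj[OF x0cl ycl y0cl] segy[of 0] by simp
  let ?I = "{-1<..<1::real}"
  obtain y' y'' where cy: "inner_C1_curve Y ?I y y'"
    and y'': "\<And>t. t \<in> ?I \<Longrightarrow> (y' has_vector_derivative y'' t) (at t)"
    and resp: "\<And>t v. t \<in> ?I \<Longrightarrow> D [(0, y' t), (v, 0)] (?x, y t) = (\<delta> *\<^sub>R d') \<bullet> v"
    and inj: "\<And>z v w. z \<in> closure Y \<Longrightarrow>
           (\<And>i. i \<in> Basis \<Longrightarrow> D [(0, v), (i, 0)] (?x, z) = D [(0, w), (i, 0)] (?x, z)) \<Longrightarrow> v = w"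
    by (rule y_segment_curve[OF x0cl, of "-1" 1 y "grad_x ?x y0" "\<delta> *\<^sub>R d'"])
       (use ycl segy in auto)
  have y'0: "y' 0 = \<delta> *\<^sub>R w"
  proof (rule inj[OF y0cl])
    fix i :: "real^'n" assume "i \<in> Basis"
    then show "D [(0, y' 0), (i, 0)] (?x, y0) = D [(0, \<delta> *\<^sub>R w), (i, 0)] (?x, y0)"
      using resp[of 0 i] linear_scale[OF linear_right[OF _ x0cl y0cl, of "[(i, 0)]"], of \<delta> w]
      by (simp add: \<open>y 0 = y0\<close> d'i)
  qed
  define X' where "X' s = x (\<sigma> + \<delta> * s)" for s
  have X'cl: "X' s \<in> closure X" if "s \<in> {-1..1}" for s unfolding X'_def by (rule xcl[OF J[OF that]])
  have segX: "grad_y (X' s) y0 = (p + \<sigma> *\<^sub>R d) + s *\<^sub>R (\<delta> *\<^sub>R d)" if "s \<in> {-1..1}" for s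
    unfolding X'_def seg[OF J[OF that]] by (simp add: algebra_simps)
  have "(deriv ^^ 2) (\<lambda>s. (deriv ^^ 2) (\<lambda>t. b (X' s) (y t)) 0) 0 \<ge> 0"
  proof (rule B3[unfolded B3_def, rule_format])
    show "X' t \<in> closure X \<and> y t \<in> closure Y" if "t \<in> {-1..1}" for t
      using X'cl[OF that] ycl[OF that] by simp
    show "\<exists>p d. \<forall>t\<in>{-1..1}. (grad_y (X' t) (y 0), grad_x (X' 0) (y t)) = p + t *\<^sub>R d"
      by (intro exI[of _ "(p + \<sigma> *\<^sub>R d, grad_x ?x y0)"] exI[of _ "(\<delta> *\<^sub>R d, \<delta> *\<^sub>R d')"] ballI)
         (simp add: \<open>y 0 = y0\<close> segX segy, simp add: X'_def segy)
  qed
  moreover have "(deriv ^^ 2) (\<lambda>s. (deriv ^^ 2) (\<lambda>t. b (X' s) (y t)) 0) 0 = \<delta> ^ 4 * m"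
  proof -
    define G where "G s = ((p + \<sigma> *\<^sub>R d) + s *\<^sub>R (\<delta> *\<^sub>R d)) \<bullet> y'' 0 + \<delta>\<^sup>2 * hess D [] (0, w) (x (\<sigma> + \<delta> * s), y0)" for s
    have "(0, y' 0) = \<delta> *\<^sub>R (0 :: real^'n, w)" by (simp add: y'0)
    then have G: "(deriv ^^ 2) (\<lambda>t. b (X' s) (y t)) 0 = G s" if "s \<in> ?I" for s
      using b_y_curve_deriv2[OF cy X'cl _ y'', of s 0] segX[of s] that
      by (simp only: hess_scale) (simp add: G_def \<open>y 0 = y0\<close> X'_def)
    have G': "(G has_real_derivative (\<delta> *\<^sub>R d) \<bullet> y'' 0 + \<delta>\<^sup>2 * (h' (\<sigma> + \<delta> * s) * \<delta>)) (at s)"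
      if "s \<in> ?I" for s
    proof -
      have lin: "((\<lambda>s. \<sigma> + \<delta> * s) has_real_derivative \<delta>) (at s)"
        by (auto intro!: derivative_eq_intros)
      have "((\<lambda>s. ((p + \<sigma> *\<^sub>R d) + s *\<^sub>R (\<delta> *\<^sub>R d)) \<bullet> y'' 0) has_real_derivative (\<delta> *\<^sub>R d) \<bullet> y'' 0) (at s)"
        by (auto intro!: derivative_eq_intros simp: inner_add_left has_real_derivative_iff_has_vector_derivative)
      moreover have "((\<lambda>s. hess D [] (0, w) (x (\<sigma> + \<delta> * s), y0)) has_real_derivative h' (\<sigma> + \<delta> * s) * \<delta>) (at s)"
        using DERIV_chain2[OF h'[OF J] lin] that by simp
      ultimately show ?thesis unfolding G_def by (intro DERIV_add DERIV_cmult)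
    qed
    have G'': "((\<lambda>s. (\<delta> *\<^sub>R d) \<bullet> y'' 0 + \<delta>\<^sup>2 * (h' (\<sigma> + \<delta> * s) * \<delta>)) has_real_derivative \<delta> ^ 4 * m) (at 0)"
    proof -
      have lin: "((\<lambda>s. \<sigma> + \<delta> * s) has_real_derivative \<delta>) (at 0)"
        by (auto intro!: derivative_eq_intros)
      have "((\<lambda>s. h' (\<sigma> + \<delta> * s)) has_real_derivative m * \<delta>) (at 0)"
        by (rule DERIV_chain2[OF _ lin]) (use h'' in simp)
      then have "((\<lambda>s. (\<delta> *\<^sub>R d) \<bullet> y'' 0 + \<delta>\<^sup>2 * (h' (\<sigma> + \<delta> * s) * \<delta>)) has_real_derivative
          0 + \<delta>\<^sup>2 * (m * \<delta> * \<delta>)) (at 0)"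
        by (intro DERIV_add DERIV_const DERIV_cmult DERIV_cmult_right)
      then show ?thesis by (simp add: power2_eq_square power4_eq_xxxx mult_ac)
    qed
    have "((\<lambda>s. (deriv ^^ 2) (\<lambda>t. b (X' s) (y t)) 0) has_real_derivative
        (\<delta> *\<^sub>R d) \<bullet> y'' 0 + \<delta>\<^sup>2 * (h' (\<sigma> + \<delta> * s) * \<delta>)) (at s)" if "s \<in> ?I" for s
      by (rule has_field_derivative_transform_within_open[OF G'[OF that] _ that]) (use G in auto)
    then show ?thesis by (intro deriv2I[OF _ _ _ G'', of ?I]) auto
  qed
  ultimately show ?thesis using \<delta> by (simp add: zero_le_mult_iff)
qed

text \<open>Join \<open>x0\<close> to \<open>x1\<close> by the curve \<open>x s\<close> along which \<open>D\<^sub>yb(x s, y \<tau>)\<close> is a segment, and let \<open>k s\<close> be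
  the expression in question at \<open>x s\<close>. It is convex by \<open>B3_imp_hess_nonneg\<close>. Its derivative at \<open>0\<close>
  is, by symmetry of the third derivatives, the derivative in \<open>t\<close> of the mixed second derivative of
  \<open>b\<close> along \<open>y\<close> at \<open>x0\<close>, which is constant since \<open>y\<close> is a \<open>b\<close>-segment seen from \<open>x0\<close>.\<close>

lemma B3_imp_second_derivative_le:
  assumes B3: "B3 X Y b" and x01: "x0 \<in> X" "x1 \<in> X"
    and y: "\<And>t. t \<in> {l<..<r} \<Longrightarrow> y t \<in> Y"
    and seg: "\<And>t. t \<in> {l<..<r} \<Longrightarrow> grad_x x0 (y t) = p + t *\<^sub>R d"
    and cy: "inner_C1_curve Y {l<..<r} y y'"
    and y'': "\<And>t. t \<in> {l<..<r} \<Longrightarrow> (y' has_vector_derivative y'' t) (at t)"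
    and resp: "\<And>t v. t \<in> {l<..<r} \<Longrightarrow> D [(0, y' t), (v, 0)] (x0, y t) = d \<bullet> v"
    and \<tau>: "\<tau> \<in> {l<..<r}"
  shows "grad_y x0 (y \<tau>) \<bullet> y'' \<tau> + hess D [] (0, y' \<tau>) (x0, y \<tau>) \<le>
         grad_y x1 (y \<tau>) \<bullet> y'' \<tau> + hess D [] (0, y' \<tau>) (x1, y \<tau>)"
proof -
  let ?y = "y \<tau>"
  have cl: "?y \<in> closure Y" "x0 \<in> closure X" "x1 \<in> closure X"
    using y[OF \<tau>] x01 closure_subset by blast+
  let ?P = "(\<lambda>x. grad_y x ?y) ` X"
  let ?d = "grad_y x1 ?y - grad_y x0 ?y"
  obtain e where e: "e > 0" "\<And>t. t \<in> {- e<..<1 + e} \<Longrightarrow> grad_y x0 ?y + t *\<^sub>R ?d \<in> ?P"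
    using convex_segment_extends[OF grad_range(3)[OF cl(2,1)] grad_y_convex[OF cl(2,1)]] x01 by blast
  let ?J = "{- e<..<1 + e}"
  have "\<exists>x\<in>X. grad_y x ?y = grad_y x0 ?y + s *\<^sub>R ?d" if "s \<in> ?J" for s
    using e(2)[OF that] by (metis (no_types, lifting) imageE)
  then obtain x where x: "\<And>s. s \<in> ?J \<Longrightarrow> x s \<in> X"
    and segx: "\<And>s. s \<in> ?J \<Longrightarrow> grad_y (x s) ?y = grad_y x0 ?y + s *\<^sub>R ?d" by metis
  have xcl: "x s \<in> closure X" if "s \<in> ?J" for s using x[OF that] closure_subset by blast
  have J01: "s \<in> ?J" if "0 \<le> s" "s \<le> 1" for s using e(1) that by auto
  have "x 0 = x0" by (rule grad_y_inj[OF cl(1) xcl[OF J01] cl(2)]) (use segx[OF J01, of 0] in auto)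
  have "x 1 = x1" by (rule grad_y_inj[OF cl(1) xcl[OF J01] cl(3)]) (use segx[OF J01, of 1] in auto)
  obtain x' x'' where cx: "inner_C1_curve X ?J x x'"
    and x'': "\<And>s. s \<in> ?J \<Longrightarrow> (x' has_vector_derivative x'' s) (at s)"
    and respx: "\<And>s v. s \<in> ?J \<Longrightarrow> D [(x' s, 0), (0, v)] (x s, ?y) = ?d \<bullet> v"
    by (rule x_segment_curve[OF cl(1), of "- e" "1 + e" x "grad_y x0 ?y" ?d]) (use e(1) xcl segx in auto)
  let ?w = "(0, y' \<tau>)"
  define h' where "h' = (\<lambda>s. \<Sum>i\<in>Basis. \<Sum>j\<in>Basis. (?w \<bullet> i) * (?w \<bullet> j) * D [(x' s, 0), j, i] (x s, ?y))"
  have "\<exists>h''. \<forall>s\<in>?J. ((\<lambda>s. hess D [] ?w (x s, ?y)) has_real_derivative h' s) (at s) \<and>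
      (h' has_real_derivative h'' s) (at s)"
    unfolding h'_def by (rule hess_x_curve[OF cx cl(1) x''])
  then obtain h'' where h': "\<And>s. s \<in> ?J \<Longrightarrow> ((\<lambda>s. hess D [] ?w (x s, ?y)) has_real_derivative h' s) (at s)"
    and h'': "\<And>s. s \<in> ?J \<Longrightarrow> (h' has_real_derivative h'' s) (at s)"
    by blast
  have nonneg: "h'' s \<ge> 0" if "s \<in> ?J" for s
    by (rule B3_imp_hess_nonneg[OF B3 y[OF \<tau>] x segx h' h''[OF that] that])
  define k where "k s = (grad_y x0 ?y + s *\<^sub>R ?d) \<bullet> y'' \<tau> + hess D [] ?w (x s, ?y)" for s
  have k': "(k has_real_derivative ?d \<bullet> y'' \<tau> + h' s) (at s)" if "s \<in> ?J" for s
  proof -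
    have "((\<lambda>s. (grad_y x0 ?y + s *\<^sub>R ?d) \<bullet> y'' \<tau>) has_real_derivative ?d \<bullet> y'' \<tau>) (at s)"
      by (auto intro!: derivative_eq_intros simp: inner_add_left has_real_derivative_iff_has_vector_derivative)
    from DERIV_add[OF this h'[OF that]] show ?thesis by (simp add: k_def[abs_def])
  qed
  have k'0: "?d \<bullet> y'' \<tau> + h' 0 = 0"
  proof -
    let ?\<xi> = "(x' 0, 0)"
    have op: "open (X \<times> Y)" and z: "(x0, ?y) \<in> X \<times> Y" using openX openY x01 y[OF \<tau>] by (auto intro: open_Times)
    \<comment> \<open>The mixed second derivative along \<open>y\<close> at the base point \<open>x0\<close> is constant, so its
       derivative vanishes.\<close>
    have "((\<lambda>t. D [(0, y' t), ?\<xi>] (x0, y t)) has_vector_derivative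
           D [(0, y'' \<tau>), ?\<xi>] (x0, ?y) + hess D [?\<xi>] ?w (x0, ?y)) (at \<tau>)"
      using y_chain2[OF _ cy cl(2) \<tau> y''[OF \<tau>], of "[?\<xi>]"] by simp
    then have "((\<lambda>t. d \<bullet> x' 0) has_vector_derivative
           D [(0, y'' \<tau>), ?\<xi>] (x0, ?y) + hess D [?\<xi>] ?w (x0, ?y)) (at \<tau>)"
      by (rule has_vector_derivative_transform_within_open[OF _ _ \<tau>]) (use resp in auto)
    then have "D [(0, y'' \<tau>), ?\<xi>] (x0, ?y) + hess D [?\<xi>] ?w (x0, ?y) = 0"
      using vector_derivative_unique_at has_vector_derivative_const by blast
    moreover have "D [(0, y'' \<tau>), ?\<xi>] (x0, ?y) = ?d \<bullet> y'' \<tau>"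
      using jet_on_Clairaut[OF D _ op z, of "[]" "(0, y'' \<tau>)" ?\<xi>] respx[OF J01[of 0], of "y'' \<tau>"] \<open>x 0 = x0\<close> by simp
    moreover have "hess D [?\<xi>] ?w (x0, ?y) = h' 0"
      unfolding hess_def h'_def \<open>x 0 = x0\<close>
      by (intro sum.cong refl arg_cong2[where f="(*)"] third_derivative_symmetric[symmetric] x01 y[OF \<tau>])
    ultimately show ?thesis by simp
  qed
  have mono: "h' 0 \<le> h' s" if "0 \<le> s" "s \<le> 1" for s
    by (rule DERIV_nonneg_imp_nondecreasing[OF \<open>0 \<le> s\<close>, of h'])
       (use h'' nonneg J01 that in \<open>meson order_trans\<close>)
  have "k 0 \<le> k 1"
  proof (rule DERIV_nonneg_imp_nondecreasing[of 0 1 k])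
    fix s :: real assume s: "0 \<le> s" "s \<le> 1"
    have "?d \<bullet> y'' \<tau> + h' s \<ge> 0" using mono[OF s] k'0 by simp
    with k'[OF J01[OF s]] show "\<exists>m. (k has_real_derivative m) (at s) \<and> 0 \<le> m" by blast
  qed simp
  then show ?thesis by (simp add: k_def \<open>x 0 = x0\<close> \<open>x 1 = x1\<close>)
qed

text \<open>The \<open>b\<close>-segment is prolonged slightly beyond its endpoints, so that \<open>t\<close> ranges over an open
  interval containing \<open>[0, 1]\<close>.\<close>

lemma B3_imp_segment_convexity:
  assumes B3: "B3 X Y b"
  shows "segment_convexity X Y"
  unfolding segment_convexity_def
proof (intro ballI impI)
  fix x x0 y0 y1 z t
  assume x: "x \<in> X" "x0 \<in> X" and y01: "y0 \<in> Y" "y1 \<in> Y" and zcl: "z \<in> closure Y"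
    and t: "t \<in> {0..1::real}" and z: "grad_x x0 z = (1 - t) *\<^sub>R grad_x x0 y0 + t *\<^sub>R grad_x x0 y1"
  have cl: "x \<in> closure X" "x0 \<in> closure X" "y0 \<in> closure Y" "y1 \<in> closure Y"
    using x y01 closure_subset by blast+
  let ?d = "grad_x x0 y1 - grad_x x0 y0"
  obtain e where e: "e > 0" "\<And>t. t \<in> {- e<..<1 + e} \<Longrightarrow> grad_x x0 y0 + t *\<^sub>R ?d \<in> grad_x x0 ` Y"
    using convex_segment_extends[OF grad_range(1)[OF cl(2,3)] grad_x_convex[OF cl(2,3)]] y01 by blast
  let ?I = "{- e<..<1 + e}"
  have "\<exists>y\<in>Y. grad_x x0 y = grad_x x0 y0 + s *\<^sub>R ?d" if "s \<in> ?I" for s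
    using e(2)[OF that] by (metis (no_types, lifting) imageE)
  then obtain y where y: "\<And>s. s \<in> ?I \<Longrightarrow> y s \<in> Y"
    and seg: "\<And>s. s \<in> ?I \<Longrightarrow> grad_x x0 (y s) = grad_x x0 y0 + s *\<^sub>R ?d" by metis
  have ycl: "y s \<in> closure Y" if "s \<in> ?I" for s using y[OF that] closure_subset by blast
  have I01: "s \<in> ?I" if "0 \<le> s" "s \<le> 1" for s using e(1) that by auto
  have "y 0 = y0" by (rule grad_x_inj[OF cl(2) ycl[OF I01] cl(3)]) (use seg[OF I01, of 0] in auto)
  moreover have "y 1 = y1" by (rule grad_x_inj[OF cl(2) ycl[OF I01] cl(4)]) (use seg[OF I01, of 1] in auto)
  moreover have "y t = z"
  proof (rule grad_x_inj[OF cl(2) ycl[OF I01] zcl])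
    show "grad_x x0 (y t) = grad_x x0 z"
      unfolding z using seg[OF I01, of t] t by (simp add: algebra_simps)
  qed (use t in auto)
  ultimately have ends: "y 0 = y0" "y 1 = y1" "y t = z" .
  obtain y' y'' where cy: "inner_C1_curve Y ?I y y'"
    and y'': "\<And>t. t \<in> ?I \<Longrightarrow> (y' has_vector_derivative y'' t) (at t)"
    and resp: "\<And>t v. t \<in> ?I \<Longrightarrow> D [(0, y' t), (v, 0)] (x0, y t) = ?d \<bullet> v"
    by (rule y_segment_curve[OF cl(2), of "- e" "1 + e" y "grad_x x0 y0" ?d]) (use e(1) ycl seg in auto)
  define h where "h t = b x (y t) - b x0 (y t)" for t
  define h' where "h' t = D [(0, y' t)] (x, y t) - D [(0, y' t)] (x0, y t)" for t
  define h'' where "h'' t = (grad_y x (y t) \<bullet> y'' t + hess D [] (0, y' t) (x, y t)) -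
      (grad_y x0 (y t) \<bullet> y'' t + hess D [] (0, y' t) (x0, y t))" for t
  have "convex_on ?I h"
  proof (rule f''_ge0_imp_convex)
    show "(h has_real_derivative h' t) (at t)" if "t \<in> ?I" for t
      unfolding h_def h'_def by (intro DERIV_diff b_y_curve[OF cy] cl that)
    show "(h' has_real_derivative h'' t) (at t)" if "t \<in> ?I" for t
      unfolding h'_def h''_def by (intro DERIV_diff b_y_curve(2)[OF cy] cl that y'')
    show "0 \<le> h'' t" if "t \<in> ?I" for t
      using B3_imp_second_derivative_le[OF B3 x(2,1) y seg cy y'' resp that] by (simp add: h''_def)
  qed simp
  from convex_onD[OF this, of t 0 1] have "h t \<le> (1 - t) * h 0 + t * h 1"
    using t e(1) by simp
  then show "b x z - b x0 z \<le> (1 - t) * (b x y0 - b x0 y0) + t * (b x y1 - b x0 y1)"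
    by (simp add: h_def ends)
qed

end

section \<open>Convexity along segments and b-convex functions\<close>

text \<open>The double transform never exceeds \<open>u\<close>, and its supremum is at least \<open>u x\<close> iff \<open>x\<close> almost
  maximizes \<open>b x' y - u x'\<close> for some \<open>y\<close>. Working with almost maximizers spares any semicontinuity
  of the transforms.\<close>

lemma b_convex_functions_iff:
  "u \<in> b_convex_functions X Y b \<longleftrightarrow>
    (\<forall>x\<in>closure X. \<forall>e>0. \<exists>y\<in>closure Y. \<forall>x'\<in>closure X. b x' y - u x' \<le> b x y - u x + e)"
proof -
  let ?s = "b_star_transform X b u"
  have star_ge: "ereal (b x y - u x) \<le> ?s y" if "x \<in> closure X" for x y
    unfolding b_star_transform_def using that by (intro SUP_upper2[of x]) auto
  have star_le: "?s y \<le> ereal c" if "\<And>x. x \<in> closure X \<Longrightarrow> b x y - u x \<le> c" for y c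
    unfolding b_star_transform_def using that by (intro SUP_least) auto
  have le: "b_transform Y b ?s x \<le> ereal (u x)" if x: "x \<in> closure X" for x
    unfolding b_transform_def
  proof (rule SUP_least)
    fix y
    show "ereal (b x y) - ?s y \<le> ereal (u x)"
      using star_ge[OF x, of y] by (cases "?s y") auto
  qed
  have "ereal (u x) \<le> b_transform Y b ?s x \<longleftrightarrow>
      (\<forall>e>0. \<exists>y\<in>closure Y. \<forall>x'\<in>closure X. b x' y - u x' \<le> b x y - u x + e)"
    if x: "x \<in> closure X" for x
  proof
    assume ge: "ereal (u x) \<le> b_transform Y b ?s x"
    show "\<forall>e>0. \<exists>y\<in>closure Y. \<forall>x'\<in>closure X. b x' y - u x' \<le> b x y - u x + e"
    proof (intro allI impI)
      fix e :: real assume "e > 0"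
      then have "ereal (u x - e) < ereal (u x)" by simp
      also note ge
      finally obtain y where y: "y \<in> closure Y" "ereal (u x - e) < ereal (b x y) - ?s y"
        unfolding b_transform_def less_SUP_iff by blast
      have "b x' y - u x' \<le> b x y - u x + e" if "x' \<in> closure X" for x'
        using star_ge[OF that, of y] y(2) by (cases "?s y") auto
      with y(1) show "\<exists>y\<in>closure Y. \<forall>x'\<in>closure X. b x' y - u x' \<le> b x y - u x + e" by blast
    qed
  next
    assume *: "\<forall>e>0. \<exists>y\<in>closure Y. \<forall>x'\<in>closure X. b x' y - u x' \<le> b x y - u x + e"
    show "ereal (u x) \<le> b_transform Y b ?s x"
    proof (rule ereal_le_epsilon2)
      fix e :: real assume "e > 0"
      with * obtain y where y: "y \<in> closure Y" "\<forall>x'\<in>closure X. b x' y - u x' \<le> b x y - u x + e" by blast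
      have "ereal (u x - e) \<le> ereal (b x y) - ?s y"
        using star_le[of y "b x y - u x + e"] star_ge[OF x, of y] y(2) by (cases "?s y") auto
      also have "\<dots> \<le> b_transform Y b ?s x"
        unfolding b_transform_def using y(1) by (intro SUP_upper)
      finally show "ereal (u x) \<le> b_transform Y b ?s x + ereal e"
        by (cases "b_transform Y b ?s x") auto
    qed
  qed
  moreover have "u \<in> b_convex_functions X Y b \<longleftrightarrow> (\<forall>x\<in>closure X. ereal (u x) \<le> b_transform Y b ?s x)"
    unfolding b_convex_functions_def using le by (auto intro: antisym)
  ultimately show ?thesis by simp
qed

context bitwist_domain
begin

text \<open>Only \<open>x\<close> is interior: \<open>y\<close> may lie on the boundary, so the line through \<open>x\<close> is
  treated as a limit of lines in the product of the open sets.\<close>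

lemma b_slice_line_derivative:
  assumes x: "x \<in> X" and y: "y \<in> closure Y"
  shows "((\<lambda>s. b (x + s *\<^sub>R v) y) has_real_derivative grad_x x y \<bullet> v) (at 0)"
proof -
  obtain \<rho> where \<rho>: "\<rho> > 0" "ball x \<rho> \<subseteq> X" using x openX openE by blast
  define r where "r = \<rho> / (norm v + 1)"
  have pos: "norm v + 1 > 0" by (smt (verit) norm_ge_zero)
  have r: "r > 0" using \<rho> pos by (simp add: r_def)
  have inX: "x + s *\<^sub>R v \<in> X" if "s \<in> {-r<..<r}" for s
  proof -
    have "norm (s *\<^sub>R v) \<le> \<bar>s\<bar> * (norm v + 1)" by (simp add: mult_left_mono)
    also have "\<dots> < \<rho>" using that pos by (auto simp: r_def pos_less_divide_eq[symmetric])
    finally show ?thesis using \<rho>(2) by (auto simp: dist_norm subset_iff)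
  qed
  have c: "inner_C1_curve X {-r<..<r} (\<lambda>s. x + s *\<^sub>R v) (\<lambda>s. v)"
    unfolding inner_C1_curve_def
  proof (intro conjI)
    show "bounded ((\<lambda>s. v) ` {-r<..<r})" by (rule bounded_subset[of "{v}"]) auto
    have "((\<lambda>s. x + s *\<^sub>R v) has_vector_derivative v) (at s)" for s
      by (auto intro!: derivative_eq_intros)
    then show "\<exists>Zn Wn. (\<forall>n. \<forall>t\<in>{-r<..<r}. Zn n t \<in> X \<and> (Zn n has_vector_derivative Wn n t) (at t)) \<and>
        uniform_limit {-r<..<r} Zn (\<lambda>s. x + s *\<^sub>R v) sequentially \<and>
        uniform_limit {-r<..<r} Wn (\<lambda>s. v) sequentially"
      by - (rule exI[of _ "\<lambda>n s. x + s *\<^sub>R v"], rule exI[of _ "\<lambda>n s. v"],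
          use inX in \<open>auto simp: uniform_limit_iff\<close>)
  qed auto
  have "((\<lambda>s. D [] (x + s *\<^sub>R v, y)) has_vector_derivative D [(v, 0)] (x + 0 *\<^sub>R v, y)) (at 0)"
    by (rule x_chain[OF _ c y]) (use r in auto)
  then have "((\<lambda>s. b (x + s *\<^sub>R v) y) has_vector_derivative D [(v, 0)] (x + 0 *\<^sub>R v, y)) (at 0)"
    by (rule has_vector_derivative_transform_within_open[where S="{-r<..<r}"])
       (use r b_eq[OF subsetD[OF closure_subset inX] y] in auto)
  then show ?thesis
    using grad_x_inner[OF subsetD[OF closure_subset x] y]
    by (simp add: has_real_derivative_iff_has_vector_derivative)
qed

text \<open>Almost supporting points of \<open>u\<close> at \<open>x0\<close> accumulate at some \<open>z'\<close> such that \<open>b x z' - u x\<close> is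
  maximal at \<open>x0\<close>. Its gradient vanishes there, which identifies \<open>D\<^sub>xb(x0, z')\<close>, hence \<open>z'\<close>.\<close>

lemma convex_imp_segment_convexity:
  assumes V: "\<And>u0 u1 t. u0 \<in> b_convex_functions X Y b \<Longrightarrow> u1 \<in> b_convex_functions X Y b \<Longrightarrow>
      t \<in> {0..1} \<Longrightarrow> (\<lambda>x. (1 - t) * u0 x + t * u1 x) \<in> b_convex_functions X Y b"
  shows "segment_convexity X Y"
  unfolding segment_convexity_def
proof (intro ballI impI)
  fix x x0 y0 y1 z t
  assume x: "x \<in> X" "x0 \<in> X" and y01: "y0 \<in> Y" "y1 \<in> Y" and zcl: "z \<in> closure Y"
    and t: "t \<in> {0..1::real}" and z: "grad_x x0 z = (1 - t) *\<^sub>R grad_x x0 y0 + t *\<^sub>R grad_x x0 y1"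
  have cl: "x \<in> closure X" "x0 \<in> closure X" "y0 \<in> closure Y" "y1 \<in> closure Y"
    using x y01 closure_subset by blast+
  have slice: "(\<lambda>x. b x y) \<in> b_convex_functions X Y b" if "y \<in> closure Y" for y
    unfolding b_convex_functions_iff using that by (auto intro!: bexI[of _ y])
  define u where "u x = (1 - t) * b x y0 + t * b x y1" for x
  have "u \<in> b_convex_functions X Y b"
    unfolding u_def[abs_def] by (intro V slice cl t)
  then have "\<exists>y\<in>closure Y. \<forall>x'\<in>closure X. b x' y - u x' \<le> b x0 y - u x0 + inverse (real (Suc n))" for n
    unfolding b_convex_functions_iff using cl(2) by simp
  then obtain yn where yn: "\<And>n. yn n \<in> closure Y"
    "\<And>n x'. x' \<in> closure X \<Longrightarrow> b x' (yn n) - u x' \<le> b x0 (yn n) - u x0 + inverse (real (Suc n))"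
    by metis
  have "compact (closure Y)" using bdY by simp
  then obtain z' r where z': "z' \<in> closure Y" and r: "strict_mono r" and lim: "(yn \<circ> r) \<longlonglongrightarrow> z'"
    unfolding compact_def using yn(1) by meson
  have max: "b x' z' - u x' \<le> b x0 z' - u x0" if x': "x' \<in> closure X" for x'
  proof (rule LIMSEQ_le)
    show "(\<lambda>n. b x' ((yn \<circ> r) n) - u x') \<longlonglongrightarrow> b x' z' - u x'"
      by (intro tendsto_intros b_tendsto lim) (use yn x' z' in auto)
    have "(\<lambda>n. b x0 ((yn \<circ> r) n) - u x0 + ((\<lambda>n. inverse (real (Suc n))) \<circ> r) n) \<longlonglongrightarrow> b x0 z' - u x0 + 0"
      by (intro tendsto_intros b_tendsto lim LIMSEQ_subseq_LIMSEQ[OF LIMSEQ_inverse_real_of_nat r])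
         (use yn cl z' in auto)
    then show "(\<lambda>n. b x0 ((yn \<circ> r) n) - u x0 + ((\<lambda>n. inverse (real (Suc n))) \<circ> r) n) \<longlonglongrightarrow> b x0 z' - u x0"
      by simp
    show "\<exists>N. \<forall>n\<ge>N. b x' ((yn \<circ> r) n) - u x' \<le>
        b x0 ((yn \<circ> r) n) - u x0 + ((\<lambda>n. inverse (real (Suc n))) \<circ> r) n"
      using yn(2)[OF x'] by (auto simp del: of_nat_Suc)
  qed
  have "grad_x x0 z' \<bullet> v = ((1 - t) *\<^sub>R grad_x x0 y0 + t *\<^sub>R grad_x x0 y1) \<bullet> v" for v
  proof -
    obtain \<rho> where \<rho>: "\<rho> > 0" "ball x0 \<rho> \<subseteq> X" using x openX openE by blast
    define f where "f s = b (x0 + s *\<^sub>R v) z' - u (x0 + s *\<^sub>R v)" for s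
    let ?m = "grad_x x0 z' \<bullet> v - ((1 - t) * (grad_x x0 y0 \<bullet> v) + t * (grad_x x0 y1 \<bullet> v))"
    have "(f has_real_derivative ?m) (at 0)"
      unfolding f_def u_def
      by (intro DERIV_diff DERIV_add DERIV_cmult b_slice_line_derivative x z' cl)
    moreover have "0 < \<rho> / (norm v + 1)" using \<rho>(1) by (smt (verit) divide_pos_pos norm_ge_zero)
    moreover have "\<forall>s. \<bar>0 - s\<bar> < \<rho> / (norm v + 1) \<longrightarrow> f s \<le> f 0"
    proof (intro allI impI)
      fix s assume s: "\<bar>0 - s\<bar> < \<rho> / (norm v + 1)"
      have pos: "norm v + 1 > 0" by (smt (verit) norm_ge_zero)
      have "norm (s *\<^sub>R v) \<le> \<bar>s\<bar> * (norm v + 1)" by (simp add: mult_left_mono)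
      also have "\<dots> < \<rho>" using s pos by (simp add: pos_less_divide_eq)
      finally have "x0 + s *\<^sub>R v \<in> X" using \<rho>(2) by (auto simp: dist_norm subset_iff)
      then show "f s \<le> f 0" using max[OF subsetD[OF closure_subset]] by (simp add: f_def)
    qed
    ultimately have "?m = 0" by (rule DERIV_local_max)
    then show ?thesis by (simp add: inner_add_left)
  qed
  then have "grad_x x0 z' = grad_x x0 z" unfolding z by (metis inner_commute vector_eq_rdot)
  then have "z' = z" using grad_x_inj[OF cl(2) z' zcl] by simp
  then show "b x z - b x0 z \<le> (1 - t) * (b x y0 - b x0 y0) + t * (b x y1 - b x0 y1)"
    using max[OF cl(1)] by (simp add: u_def algebra_simps)
qed

text \<open>If \<open>y0\<close> and \<open>y1\<close> almost support \<open>u0\<close> and \<open>u1\<close> at \<open>x\<close>, the point \<open>z\<close> of the \<open>b\<close>-segment between them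
  almost supports the combination, with the same error.\<close>

lemma segment_convexity_imp_convex:
  assumes C: "segment_convexity (closure X) (closure Y)"
    and u: "u0 \<in> b_convex_functions X Y b" "u1 \<in> b_convex_functions X Y b" and t: "t \<in> {0..1}"
  shows "(\<lambda>x. (1 - t) * u0 x + t * u1 x) \<in> b_convex_functions X Y b"
  unfolding b_convex_functions_iff
proof (intro ballI allI impI)
  fix x and e :: real assume x: "x \<in> closure X" and "e > 0"
  from u \<open>e > 0\<close> x obtain y0 y1 where y: "y0 \<in> closure Y" "y1 \<in> closure Y"
    and y0: "\<And>x'. x' \<in> closure X \<Longrightarrow> b x' y0 - u0 x' \<le> b x y0 - u0 x + e"
    and y1: "\<And>x'. x' \<in> closure X \<Longrightarrow> b x' y1 - u1 x' \<le> b x y1 - u1 x + e"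
    unfolding b_convex_functions_iff by meson
  have "convex (grad_x x ` closure Y)"
    using convex_closure[OF grad_x_convex[OF x y(1)]] grad_range(2)[OF x y(1)] by simp
  then have "(1 - t) *\<^sub>R grad_x x y0 + t *\<^sub>R grad_x x y1 \<in> grad_x x ` closure Y"
    by (rule convexD) (use y t in auto)
  then obtain z where z: "z \<in> closure Y" "grad_x x z = (1 - t) *\<^sub>R grad_x x y0 + t *\<^sub>R grad_x x y1" by auto
  show "\<exists>y\<in>closure Y. \<forall>x'\<in>closure X.
      b x' y - ((1 - t) * u0 x' + t * u1 x') \<le> b x y - ((1 - t) * u0 x + t * u1 x) + e"
  proof (intro bexI[OF _ z(1)] ballI)
    fix x' assume x': "x' \<in> closure X"
    have "b x' z - b x z \<le> (1 - t) * (b x' y0 - b x y0) + t * (b x' y1 - b x y1)"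
      by (rule segment_convexityD[OF C x' x y z(1)]) (use t z(2) in auto)
    also have "\<dots> \<le> (1 - t) * (u0 x' - u0 x + e) + t * (u1 x' - u1 x + e)"
      using y0[OF x'] y1[OF x'] t by (intro add_mono mult_left_mono) auto
    finally show "b x' z - ((1 - t) * u0 x' + t * u1 x') \<le> b x z - ((1 - t) * u0 x + t * u1 x) + e"
      by (simp add: algebra_simps)
  qed
qed

end

theorem theorem3p2:
  fixes X Y :: "(real^'n) set" and b :: "real^'n \<Rightarrow> real^'n \<Rightarrow> real"
  assumes "open X" and "bounded X" and "open Y" and "bounded Y"
    and "B0 X Y b" and "B1 X Y b" and "B2 X Y b"
  shows "(\<forall>u0\<in>b_convex_functions X Y b. \<forall>u1\<in>b_convex_functions X Y b. \<forall>t\<in>{0..1}.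
            (\<lambda>x. (1 - t) * u0 x + t * u1 x) \<in> b_convex_functions X Y b)
         \<longleftrightarrow> B3 X Y b"
proof -
  have op: "open (X \<times> Y)" using assms by (auto intro: open_Times)
  from \<open>B0 X Y b\<close> have cont: "continuous_on (closure (X \<times> Y)) (\<lambda>(x, y). b x y)"
    and ext: "extends_Ck 4 (X \<times> Y) (\<lambda>(x, y). b x y)"
    by (auto simp: B0_def Ck_closure_def)
  obtain D where D: "jet_on 4 (X \<times> Y) D"
    and D0: "\<And>z. z \<in> X \<times> Y \<Longrightarrow> D [] z = (case z of (x, y) \<Rightarrow> b x y)"
    using extends_Ck_imp_jet_on[OF ext op] by blast
  have "D [] z = (case z of (x, y) \<Rightarrow> b x y)" if "z \<in> closure (X \<times> Y)" for z
    by (rule continuous_eq_on_closure[OF jet_on_cont[OF D] cont D0 that]) auto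
  then have "b x y = D [] (x, y)" if "x \<in> closure X" "y \<in> closure Y" for x y
    using that by (simp add: closure_Times)
  then interpret bitwist_domain X Y b D
    using assms D by unfold_locales
  show ?thesis
  proof
    assume "\<forall>u0\<in>b_convex_functions X Y b. \<forall>u1\<in>b_convex_functions X Y b. \<forall>t\<in>{0..1}.
            (\<lambda>x. (1 - t) * u0 x + t * u1 x) \<in> b_convex_functions X Y b"
    then have "segment_convexity X Y" by (intro convex_imp_segment_convexity) blast
    then show "B3 X Y b" by (intro segment_convexity_imp_B3 segment_convexity_closure)
  next
    assume "B3 X Y b"
    then have "segment_convexity (closure X) (closure Y)"
      by (intro segment_convexity_closure B3_imp_segment_convexity)
    then show "\<forall>u0\<in>b_convex_functions X Y b. \<forall>u1\<in>b_convex_functions X Y b. \<forall>t\<in>{0..1}.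
            (\<lambda>x. (1 - t) * u0 x + t * u1 x) \<in> b_convex_functions X Y b"
      by (blast intro: segment_convexity_imp_convex)
  qed
qed

end
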